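(* Suppose $p=p(n)$ satisfies $p=\omega(1/n)$. Then: (i) For any integer $r\ge 0$, with high probability the largest induced $\vee_{r+1}$-free subfamily of $\mathcal P(n,p)$ has size $(1+o(1))p\binom{n}{\lfloor n/2\rfloor}$. (ii) For any pair of integers $s,t\ge 1$, with high probability the largest induced $K_{s,1,t}$-free subfamily of $\mathcal P(n,p)$ has size $(2+o(1))p\binom{n}{\lfloor n/2\rfloor}$.
   Context: $\mathcal P(n,p)$ is the random subfamily of $2^{[n]}$ containing each $F\subseteq[n]$ independently with probability $p$. An event holds with high probability if its probability tends to $1$ as $n\to\infty$. For a finite poset $(P,\le)$, an induced copy of $P$ in $\mathcal F$ is a subfamily $\mathcal G\subseteq\mathcal F$ with a bijection $i:P\to\mathcal G$ such that $p\le q$ iff $i(p)\subseteq i(q)$; $\mathcal F$ is induced $P$-free if it contains no induced copy. $\vee_{k}$ is the poset $a<b_1,\dots,b_k$ with the $b_j$ pairwise incomparable. $K_{s,1,t}$ is the poset on $a_1,\dots,a_s,b,c_1,\dots,c_t$ with $a_j<b<c_k$ for all $j,k$, the $a_j$ pairwise incomparable and the $c_k$ pairwise incomparable. *)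

theory Defs
  imports "HOL-Probability.Probability" "HOL-Library.Landau_Symbols"
begin

text \<open>
  A poset is a pair of a carrier set and its (reflexive) order, given as a relation on that carrier.
\<close>

type_synonym 'a poset = "'a set \<times> ('a \<times> 'a) set"

definition induced_copy :: "'a poset \<Rightarrow> 'b set set \<Rightarrow> bool" where
  "induced_copy P G \<longleftrightarrow>
     (\<exists>i. bij_betw i (fst P) G \<and> (\<forall>x\<in>fst P. \<forall>y\<in>fst P. (x, y) \<in> snd P \<longleftrightarrow> i x \<subseteq> i y))"

definition induced_free :: "'a poset \<Rightarrow> 'b set set \<Rightarrow> bool" where
  "induced_free P F \<longleftrightarrow> \<not> (\<exists>G\<subseteq>F. induced_copy P G)"

text \<open>
  This is only meaningful for finite \<open>F\<close> and nonempty \<open>P\<close>; then the empty subfamily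
  is induced \<open>P\<close>-free and the maximum is attained.
\<close>

definition largest_free :: "'a poset \<Rightarrow> 'b set set \<Rightarrow> nat" where
  "largest_free P F = Max {card G | G. G \<subseteq> F \<and> induced_free P G}"

datatype vee_elt = Bottom | Upper nat

definition vee :: "nat \<Rightarrow> vee_elt poset" where
  "vee k = (let V = {Bottom} \<union> Upper ` {1..k} in
     (V, Id_on V \<union> {Bottom} \<times> Upper ` {1..k}))"

datatype k_elt = KA nat | KB | KC nat

definition K_poset :: "nat \<Rightarrow> nat \<Rightarrow> k_elt poset" where
  "K_poset s t = (let A = KA ` {1..s}; C = KC ` {1..t}; V = A \<union> {KB} \<union> C in
     (V, Id_on V \<union> A \<times> {KB} \<union> {KB} \<times> C \<union> A \<times> C))"

lemma partial_order_vee: "partial_order_on (fst (vee k)) (snd (vee k))"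
  by (auto simp: vee_def Let_def partial_order_on_def preorder_on_def
        refl_on_def trans_def antisym_def)

lemma partial_order_K_poset: "partial_order_on (fst (K_poset s t)) (snd (K_poset s t))"
  by (auto simp: K_poset_def Let_def partial_order_on_def preorder_on_def
        refl_on_def trans_def antisym_def)

definition random_family :: "nat \<Rightarrow> real \<Rightarrow> nat set set pmf" where
  "random_family n p =
     map_pmf (\<lambda>f. {F \<in> Pow {1..n}. f F}) (Pi_pmf (Pow {1..n}) False (\<lambda>_. bernoulli_pmf p))"

definition whp :: "(nat \<Rightarrow> 'a pmf) \<Rightarrow> (nat \<Rightarrow> 'a \<Rightarrow> bool) \<Rightarrow> bool" where
  "whp M E \<longleftrightarrow> (\<lambda>n. measure_pmf.prob (M n) {x. E n x}) \<longlonglongrightarrow> 1"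

text \<open>
  ``With high probability \<open>X n = (c + o(1)) * a n\<close>'': the error is bounded by a deterministic
  null sequence \<open>\<delta>\<close>, chosen independently of the random outcome.
\<close>

definition whp_asymp ::
    "(nat \<Rightarrow> 'a pmf) \<Rightarrow> (nat \<Rightarrow> 'a \<Rightarrow> real) \<Rightarrow> real \<Rightarrow> (nat \<Rightarrow> real) \<Rightarrow> bool" where
  "whp_asymp M X c a \<longleftrightarrow>
     (\<exists>\<delta> :: nat \<Rightarrow> real. \<delta> \<in> o(\<lambda>_. 1) \<and>
        whp M (\<lambda>n x. (c - \<delta> n) * a n \<le> X n x \<and> X n x \<le> (c + \<delta> n) * a n))"

end

theory Submission
  imports Defs "HOL-Combinatorics.Multiset_Permutations" "HOL-Real_Asymp.Real_Asymp"
begin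

text \<open>
  Let \<open>X\<close> be the size of a largest free subfamily of the random subset of \<open>C\<close>. The upper bound
  estimates the exponential moment \<open>Z C = E (exp (\<theta> * X))\<close> by a recursion on \<open>C\<close>. Suppose some
  \<open>v \<in> C\<close> has sets \<open>N1, N2 \<subseteq> C - {v}\<close> with at least \<open>\<Delta>\<close> elements each, such that every free family
  containing \<open>v\<close> has at most \<open>s\<close> members in \<open>N1\<close> or at most \<open>s\<close> in \<open>N2\<close>. Splitting according to
  whether an optimal family uses \<open>v\<close> gives, with \<open>C' = C - {v}\<close>,
  \<open>Z C \<le> Z C' + p * exp (\<theta> * (s + 1)) * (Z (C' - N1) + Z (C' - N2))\<close>.
  Hence each element of \<open>C\<close> costs only a factor \<open>exp y\<close> as soon as
  \<open>y * exp (y * \<Delta>) \<ge> 2 * p * exp (\<theta> * (s + 1))\<close>.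
  For an upper (or lower) layer of neighbours of \<open>v\<close>, which is an antichain, such a sparsity condition
  is exactly what forbidding the poset yields.

  Averaging over random maximal chains shows that \<open>v\<close> exists with \<open>\<Delta> = \<delta> * n\<close> as long as \<open>C\<close>
  exceeds \<open>c + \<epsilon>\<close> times the middle binomial coefficient \<open>N\<close>, where \<open>c\<close> is \<open>1\<close> for
  \<open>vee\<close> and \<open>2\<close> for \<open>K_poset\<close>, and with \<open>\<Delta> = n\<^sup>3\<close> as long as \<open>C\<close>
  exceeds a constant times \<open>N\<close>. As \<open>p * n\<close> tends to infinity, both phases together cost a factor
  \<open>exp (o(p * N))\<close>, and Markov's inequality finishes the upper bound. The lower bound is given by the
  middle layer or the two middle layers.
\<close>

section \<open>Random subsets\<close>

text \<open>The ground set is arbitrary because the recursion deletes elements from it;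
  \<open>random_family\<close> is the case of a full power set.\<close>

definition random_subset :: "'a set \<Rightarrow> real \<Rightarrow> 'a set pmf" where
  "random_subset V p = map_pmf (\<lambda>f. {x \<in> V. f x}) (Pi_pmf V False (\<lambda>_. bernoulli_pmf p))"

lemma random_family_eq: "random_family n p = random_subset (Pow {1..n}) p"
  by (simp add: random_family_def random_subset_def)

lemma set_pmf_random_subset: "set_pmf (random_subset V p) \<subseteq> Pow V"
  by (auto simp: random_subset_def)

lemma integrable_random_subset [simp, intro]:
  fixes g :: "'a set \<Rightarrow> real"
  assumes "finite V"
  shows "integrable (measure_pmf (random_subset V p)) g"
  using assms finite_subset[OF set_pmf_random_subset] 
  by (intro integrable_measure_pmf_finite) auto

lemma random_subset_insert:
  assumes "finite V" "v \<notin> V"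
  shows "random_subset (insert v V) p =
    bind_pmf (bernoulli_pmf p) (\<lambda>b. map_pmf (\<lambda>P. if b then insert v P else P) (random_subset V p))"
proof -
  have eq: "{x \<in> insert v V. (f(v := b)) x} =
     (if b then insert v {x \<in> V. f x} else {x \<in> V. f x})" for b f
    using assms by auto
  show ?thesis
    unfolding random_subset_def Pi_pmf_insert'[OF assms] map_pmf_def bind_assoc_pmf bind_return_pmf eq ..
qed

lemma expectation_random_subset_insert:
  fixes g :: "'a set \<Rightarrow> real"
  assumes "finite V" "v \<notin> V" "0 \<le> p" "p \<le> 1"
  shows "measure_pmf.expectation (random_subset (insert v V) p) g =
    (1 - p) * measure_pmf.expectation (random_subset V p) g +
    p * measure_pmf.expectation (random_subset V p) (\<lambda>P. g (insert v P))"
proof -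
  have fin: "finite (set_pmf (random_subset V p))"
    using assms(1) finite_subset[OF set_pmf_random_subset] by auto
  show ?thesis
    unfolding random_subset_insert[OF assms(1,2)]
    by (subst pmf_expectation_bind[of UNIV]) (use assms fin in \<open>auto simp: UNIV_bool\<close>)
qed

lemma random_subset_restrict:
  assumes "finite V" "W \<subseteq> V"
  shows "map_pmf (\<lambda>P. P \<inter> W) (random_subset V p) = random_subset W p"
  unfolding random_subset_def Pi_pmf_subset[OF assms] map_pmf_comp
  using assms(2) by (intro map_pmf_cong) auto

lemma expectation_random_subset_restrict:
  fixes g :: "'a set \<Rightarrow> real"
  assumes "finite V" "W \<subseteq> V"
  shows "measure_pmf.expectation (random_subset V p) (\<lambda>P. g (P \<inter> W)) =
    measure_pmf.expectation (random_subset W p) g"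
  unfolding random_subset_restrict[OF assms, symmetric] by simp

text \<open>This is the moment generating function of a binomial variable: each new element
  multiplies it by \<open>1 - p + p * exp \<theta>\<close>.\<close>

lemma expectation_exp_card_random_subset:
  assumes "finite V" "0 \<le> p" "p \<le> 1"
  shows "measure_pmf.expectation (random_subset V p) (\<lambda>P. exp (\<theta> * real (card P)))
    = (1 + p * (exp \<theta> - 1)) ^ card V"
  using assms(1)
proof induction
  case empty
  have "random_subset {} p = (return_pmf {} :: 'a set pmf)"
    using set_pmf_random_subset[of "{}" p] set_pmf_not_empty[of "random_subset {} p"]
    by (metis Pow_empty set_pmf_subset_singleton)
  then show ?case by simp
next
  case (insert v V)
  have "measure_pmf.expectation (random_subset V p) (\<lambda>P. exp (\<theta> * real (card (insert v P))))
    = measure_pmf.expectation (random_subset V p) (\<lambda>P. exp \<theta> * exp (\<theta> * real (card P)))"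
    by (intro integral_cong_AE)
      (use set_pmf_random_subset[of V p] insert finite_subset[OF _ insert(1)] in
        \<open>auto simp: AE_measure_pmf_iff card_insert_if algebra_simps exp_add subset_iff\<close>)
  then show ?case
    using insert assms by (simp add: expectation_random_subset_insert algebra_simps)
qed

text \<open>Follows from \<open>1 + x \<le> exp x\<close>. The sign of \<theta> is left open:
  positive values serve the upper tail, negative ones the lower tail.\<close>

lemma expectation_exp_card_random_subset_le:
  assumes "finite V" "0 \<le> p" "p \<le> 1"
  shows "measure_pmf.expectation (random_subset V p) (\<lambda>P. exp (\<theta> * real (card P)))
    \<le> exp (p * (exp \<theta> - 1) * card V)"
proof -
  have "0 \<le> 1 + p * (exp \<theta> - 1)"
    unfolding right_diff_distrib using assms mult_nonneg_nonneg[of p "exp \<theta>"] exp_ge_zero[of \<theta>] by linarith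
  moreover have "1 + p * (exp \<theta> - 1) \<le> exp (p * (exp \<theta> - 1))" by (rule exp_ge_add_one_self)
  ultimately have "(1 + p * (exp \<theta> - 1)) ^ card V \<le> exp (p * (exp \<theta> - 1)) ^ card V"
    by (rule power_mono[rotated])
  then show ?thesis
    unfolding expectation_exp_card_random_subset[OF assms] by (simp add: exp_of_nat2_mult)
qed

section \<open>Exponential moments of the largest free subset\<close>

definition largest_sub :: "('a set \<Rightarrow> bool) \<Rightarrow> 'a set \<Rightarrow> nat" where
  "largest_sub free F = Max {card G | G. G \<subseteq> F \<and> free G}"

lemma largest_free_eq: "largest_free P = largest_sub (induced_free P)"
  by (simp add: fun_eq_iff largest_free_def largest_sub_def)

text \<open>The recursion on exponential moments uses freeness only through these two properties and
  the sparsity condition in \<open>splits\<close>.\<close>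

locale hereditary =
  fixes free :: "'a set \<Rightarrow> bool"
  assumes free_empty: "free {}"
    and free_subset: "free G \<Longrightarrow> H \<subseteq> G \<Longrightarrow> free H"
begin

lemma largest_sub_ge:
  assumes "finite F" "G \<subseteq> F" "free G"
  shows "card G \<le> largest_sub free F"
proof -
  have "finite {card G | G. G \<subseteq> F \<and> free G}" using assms(1) by simp
  then show ?thesis unfolding largest_sub_def using assms by (intro Max_ge) auto
qed

lemma largest_sub_attained:
  assumes "finite F"
  obtains G where "G \<subseteq> F" "free G" "largest_sub free F = card G"
proof -
  have "finite {card G | G. G \<subseteq> F \<and> free G}" "{card G | G. G \<subseteq> F \<and> free G} \<noteq> {}"
    using assms free_empty by auto
  from Max_in[OF this] show ?thesis using that unfolding largest_sub_def by blast
qed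

lemma largest_sub_le_card: "finite F \<Longrightarrow> largest_sub free F \<le> card F"
  by (metis card_mono largest_sub_attained)

definition exp_moment :: "real \<Rightarrow> real \<Rightarrow> 'a set \<Rightarrow> real" where
  "exp_moment p \<theta> C =
     measure_pmf.expectation (random_subset C p) (\<lambda>P. exp (\<theta> * real (largest_sub free P)))"

text \<open>
  If a free family uses \<open>v\<close>, it misses almost all of \<open>N1\<close> or almost all of \<open>N2\<close>. So using \<open>v\<close>
  deletes at least \<open>\<Delta>\<close> other elements of \<open>C\<close>, at the price of at most \<open>s + 1\<close> chosen ones.
\<close>

definition splits :: "nat \<Rightarrow> 'a set \<Rightarrow> real \<Rightarrow> bool" where
  "splits s C \<Delta> \<longleftrightarrow> (\<exists>v\<in>C. \<exists>N1 N2. N1 \<subseteq> C - {v} \<and> N2 \<subseteq> C - {v} \<and>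
     \<Delta> \<le> card N1 \<and> \<Delta> \<le> card N2 \<and>
     (\<forall>G. free G \<longrightarrow> v \<in> G \<longrightarrow> card (G \<inter> N1) \<le> s \<or> card (G \<inter> N2) \<le> s))"

text \<open>Pointwise form of the recursion. An optimal family either avoids \<open>v\<close> and
  lies in \<open>P\<close>, or contains \<open>v\<close>; then removing \<open>v\<close> and its at
  most \<open>s\<close> members in \<open>N1\<close> or in \<open>N2\<close> leaves a free subset of
  \<open>P - N1\<close> or \<open>P - N2\<close>. The sum of the three terms covers every
  case.\<close>

lemma exp_largest_sub_insert:
  fixes \<theta> :: real
  assumes fin: "finite P" and \<theta>: "0 \<le> \<theta>"
    and sparse: "\<And>G. free G \<Longrightarrow> v \<in> G \<Longrightarrow> card (G \<inter> N1) \<le> s \<or> card (G \<inter> N2) \<le> s"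
  shows "exp (\<theta> * largest_sub free (insert v P)) \<le> exp (\<theta> * largest_sub free P) +
    exp (\<theta> * (s + 1)) * (exp (\<theta> * largest_sub free (P - N1)) + exp (\<theta> * largest_sub free (P - N2)))"
proof -
  obtain G where G: "G \<subseteq> insert v P" "free G" "largest_sub free (insert v P) = card G"
    using largest_sub_attained fin by (metis finite_insert)
  have finG: "finite G" using G fin finite_subset by blast
  show ?thesis
  proof (cases "v \<in> G")
    case False
    then have "card G \<le> largest_sub free P"
      using G fin by (intro largest_sub_ge) auto
    then have "exp (\<theta> * largest_sub free (insert v P)) \<le> exp (\<theta> * largest_sub free P)"
      using \<theta> G by (auto intro!: mult_left_mono)
    then show ?thesis by (smt (verit) exp_ge_zero mult_nonneg_nonneg)
  next
    case True
    have "exp (\<theta> * largest_sub free (insert v P)) \<le> exp (\<theta> * (s + 1)) * exp (\<theta> * largest_sub free (P - N))"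
      if "card (G \<inter> N) \<le> s" for N
    proof -
      have "G \<subseteq> insert v ((G \<inter> N) \<union> ((G - {v}) - N))" by auto
      then have "card G \<le> card (insert v ((G \<inter> N) \<union> ((G - {v}) - N)))"
        using finG by (intro card_mono) auto
      also have "\<dots> \<le> Suc (card (G \<inter> N) + card ((G - {v}) - N))"
        using finG by (intro order_trans[OF card_insert_le_m1] order_trans[OF card_Un_le] Suc_le_mono[THEN iffD2])
          (auto intro: card_Un_le simp: card_insert_if)
      also have "card ((G - {v}) - N) \<le> largest_sub free (P - N)"
        using fin G(1) by (intro largest_sub_ge free_subset[OF G(2)]) auto
      also have "Suc (card (G \<inter> N) + largest_sub free (P - N)) \<le> s + 1 + largest_sub free (P - N)"
        using that by simp
      finally have "real (largest_sub free (insert v P)) \<le> (s + 1) + real (largest_sub free (P - N))"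
        using G(3) by linarith
      then have "\<theta> * largest_sub free (insert v P) \<le> \<theta> * (s + 1) + \<theta> * largest_sub free (P - N)"
        using \<theta> by (metis distrib_left mult_left_mono)
      then show ?thesis by (simp flip: exp_add)
    qed
    with sparse[OF G(2) True] show ?thesis
      by (smt (verit) exp_ge_zero mult_nonneg_nonneg distrib_left)
  qed
qed

text \<open>
  The restrictions of the random set to \<open>C\<close>, \<open>C - N1\<close>, \<open>C - N2\<close> are independent of the coordinate
  \<open>v\<close>, which is where the factor \<open>p\<close> comes from.
\<close>

lemma exp_moment_insert:
  assumes fin: "finite C" and v: "v \<notin> C" and \<theta>: "0 \<le> \<theta>" and p: "0 \<le> p" "p \<le> 1"
    and sparse: "\<And>G. free G \<Longrightarrow> v \<in> G \<Longrightarrow> card (G \<inter> N1) \<le> s \<or> card (G \<inter> N2) \<le> s"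
  shows "exp_moment p \<theta> (insert v C) \<le> exp_moment p \<theta> C +
    p * exp (\<theta> * (s + 1)) * (exp_moment p \<theta> (C - N1) + exp_moment p \<theta> (C - N2))"
proof -
  let ?E = "measure_pmf.expectation (random_subset C p)"
  let ?X = "\<lambda>P. exp (\<theta> * real (largest_sub free P))"
  have int [simp]: "integrable (measure_pmf (random_subset C p)) g" for g :: "'a set \<Rightarrow> real"
    using fin by (rule integrable_random_subset)
  have "?E (\<lambda>P. ?X (insert v P)) \<le>
      ?E (\<lambda>P. ?X P + exp (\<theta> * (s + 1)) * (?X (P \<inter> (C - N1)) + ?X (P \<inter> (C - N2))))"
  proof (intro integral_mono_AE)
    show "AE P in measure_pmf (random_subset C p). ?X (insert v P) \<le>
      ?X P + exp (\<theta> * (s + 1)) * (?X (P \<inter> (C - N1)) + ?X (P \<inter> (C - N2)))"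
      unfolding AE_measure_pmf_iff
    proof
      fix P assume "P \<in> set_pmf (random_subset C p)"
      then have P: "P \<subseteq> C" using set_pmf_random_subset by fast
      then have "P \<inter> (C - N) = P - N" for N by auto
      then show "?X (insert v P) \<le>
        ?X P + exp (\<theta> * (s + 1)) * (?X (P \<inter> (C - N1)) + ?X (P \<inter> (C - N2)))"
        using exp_largest_sub_insert[OF _ \<theta> sparse, of P] P fin v by (auto dest: finite_subset)
    qed
  qed simp_all
  also have "\<dots> = exp_moment p \<theta> C + exp (\<theta> * (s + 1)) * (exp_moment p \<theta> (C - N1) + exp_moment p \<theta> (C - N2))"
    by (simp add: exp_moment_def expectation_random_subset_restrict[OF fin, of _ p "?X"])
  finally have "p * ?E (\<lambda>P. ?X (insert v P)) \<le> p * \<dots>"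
    using p by (intro mult_left_mono)
  then show ?thesis
    using expectation_random_subset_insert[OF fin v p, of ?X] by (simp add: exp_moment_def algebra_simps)
qed

text \<open>Strong induction on the size \<open>m\<close> of \<open>C\<close>. The smaller sets have
  \<open>m - 1\<close> and at most \<open>m - 1 - \<Delta>\<close> elements, so \<open>rate\<close>
  reduces the claim to \<open>1 + y \<le> exp y\<close>. The base bound \<open>A\<close> is a
  parameter so that the outcome of one phase can start the next.\<close>

lemma exp_moment_le_splits:
  assumes V: "finite V" and \<theta>: "0 \<le> \<theta>" and p: "0 \<le> p" "p \<le> 1" and y: "0 \<le> y" and A: "0 \<le> A"
    and base: "\<And>C. C \<subseteq> V \<Longrightarrow> real (card C) \<le> M \<Longrightarrow> exp_moment p \<theta> C \<le> A"
    and step: "\<And>C. C \<subseteq> V \<Longrightarrow> real (card C) > M \<Longrightarrow> splits s C \<Delta>"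
    and rate: "2 * p * exp (\<theta> * (s + 1)) \<le> y * exp (y * \<Delta>)"
    and "C \<subseteq> V"
  shows "exp_moment p \<theta> C \<le> A * exp (y * card C)"
  using \<open>C \<subseteq> V\<close>
proof (induction "card C" arbitrary: C rule: less_induct)
  case less
  have fin: "finite C" using less(2) V finite_subset by blast
  show ?case
  proof (cases "real (card C) \<le> M")
    case True
    have "A * 1 \<le> A * exp (y * card C)" using A y by (intro mult_left_mono) auto
    with base[OF less(2) True] show ?thesis by simp
  next
    case False
    then obtain v N1 N2 where v: "v \<in> C" and N: "N1 \<subseteq> C - {v}" "N2 \<subseteq> C - {v}"
      and D: "\<Delta> \<le> card N1" "\<Delta> \<le> card N2"
      and sparse: "\<And>G. free G \<Longrightarrow> v \<in> G \<Longrightarrow> card (G \<inter> N1) \<le> s \<or> card (G \<inter> N2) \<le> s"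
      using step[OF less(2)] unfolding splits_def by (metis not_le)
    define m where "m = real (card C)"
    have *: "exp_moment p \<theta> (C - {v} - N) \<le> A * exp (y * (m - 1 - \<Delta>))"
      if "N \<subseteq> C - {v}" "\<Delta> \<le> card N" for N
    proof -
      have c: "card (C - {v} - N) = card C - 1 - card N" and "card N \<le> card C - 1"
        using that fin v by (auto simp: card_Diff_subset finite_subset dest: card_mono[rotated])
      moreover have "0 < card C" using v fin card_gt_0_iff by blast
      ultimately have "card (C - {v} - N) < card C" and r: "real (card (C - {v} - N)) \<le> m - 1 - \<Delta>"
        using that by (auto simp: m_def)
      then have "exp_moment p \<theta> (C - {v} - N) \<le> A * exp (y * card (C - {v} - N))"
        using less by blast
      also have "\<dots> \<le> A * exp (y * (m - 1 - \<Delta>))"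
        using A y r by (intro mult_left_mono) (auto intro: mult_left_mono)
      finally show ?thesis .
    qed
    have "0 < card C" using v fin card_gt_0_iff by blast
    then have "exp_moment p \<theta> (C - {v}) \<le> A * exp (y * (m - 1))"
      using less(1)[of "C - {v}"] less(2) v fin by (auto simp: m_def of_nat_diff)
    moreover have "exp_moment p \<theta> C \<le> exp_moment p \<theta> (C - {v}) +
      p * exp (\<theta> * (s + 1)) * (exp_moment p \<theta> (C - {v} - N1) + exp_moment p \<theta> (C - {v} - N2))"
      using exp_moment_insert[of "C - {v}" v \<theta> p N1 s N2] fin v \<theta> p sparse by (simp add: insert_absorb)
    moreover have "p * exp (\<theta> * (s + 1)) * (exp_moment p \<theta> (C - {v} - N1) + exp_moment p \<theta> (C - {v} - N2))
      \<le> p * exp (\<theta> * (s + 1)) * (A * exp (y * (m - 1 - \<Delta>)) + A * exp (y * (m - 1 - \<Delta>)))"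
      using * N D p by (intro mult_left_mono add_mono) auto
    ultimately have "exp_moment p \<theta> C \<le> A * (exp (y * (m - 1)) + 2 * p * exp (\<theta> * (s + 1)) * exp (y * (m - 1 - \<Delta>)))"
      by (simp add: algebra_simps)
    also have "\<dots> \<le> A * (exp (y * (m - 1)) + y * exp (y * \<Delta>) * exp (y * (m - 1 - \<Delta>)))"
      using A rate by (intro mult_left_mono add_left_mono mult_right_mono) auto
    also have "\<dots> = A * ((1 + y) * exp (y * (m - 1)))"
      by (simp add: algebra_simps flip: exp_add)
    also have "\<dots> \<le> A * (exp y * exp (y * (m - 1)))"
      using A by (intro mult_left_mono mult_right_mono) auto
    also have "\<dots> = A * exp (y * m)" by (simp add: algebra_simps flip: exp_add)
    finally show ?thesis by (simp add: m_def)
  qed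
qed

text \<open>Bounds the free subset by the whole random set. This starts the recursion, at sets that
  are already close to the target size.\<close>

lemma exp_moment_le_card:
  assumes "finite C" "0 \<le> \<theta>" "0 \<le> p" "p \<le> 1"
  shows "exp_moment p \<theta> C \<le> exp (p * (exp \<theta> - 1) * card C)"
proof -
  have "exp_moment p \<theta> C \<le> measure_pmf.expectation (random_subset C p) (\<lambda>P. exp (\<theta> * real (card P)))"
    unfolding exp_moment_def
    by (intro integral_mono_AE)
      (use assms set_pmf_random_subset[of C p] in
        \<open>auto simp: AE_measure_pmf_iff intro!: mult_left_mono largest_sub_le_card dest!: finite_subset[OF _ assms(1)] subsetD\<close>)
  also have "\<dots> \<le> exp (p * (exp \<theta> - 1) * card C)"
    using assms by (intro expectation_exp_card_random_subset_le)
  finally show ?thesis .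
qed

end

text \<open>Allows the search for a split to be confined to the middle layers.\<close>

lemma (in hereditary) splits_mono:
  assumes "splits s C \<Delta>" "C \<subseteq> C'"
  shows "splits s C' \<Delta>"
proof -
  obtain v N1 N2 where *: "v \<in> C" "N1 \<subseteq> C - {v}" "N2 \<subseteq> C - {v}" "\<Delta> \<le> card N1" "\<Delta> \<le> card N2"
    "\<forall>G. free G \<longrightarrow> v \<in> G \<longrightarrow> card (G \<inter> N1) \<le> s \<or> card (G \<inter> N2) \<le> s"
    using assms(1) unfolding splits_def by blast
  have "v \<in> C'" "N1 \<subseteq> C' - {v}" "N2 \<subseteq> C' - {v}" using * assms(2) by auto
  with * show ?thesis unfolding splits_def by blast
qed

section \<open>Supersaturation\<close>

definition prefixes_of :: "'a list \<Rightarrow> 'a set set" where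
  "prefixes_of xs = {set (take k xs) | k. k \<le> length xs}"

lemma prefixes_of_chain:
  assumes "A \<in> prefixes_of xs" "B \<in> prefixes_of xs"
  shows "A \<subseteq> B \<or> B \<subseteq> A"
proof -
  obtain i j where "A = set (take i xs)" "B = set (take j xs)"
    using assms unfolding prefixes_of_def by blast
  then show ?thesis
    using set_take_subset_set_take[of i j xs] set_take_subset_set_take[of j i xs]
    by (cases "i \<le> j") auto
qed

text \<open>The chain of a permutation passes through \<open>A\<close> and \<open>B\<close> exactly
  if the permutation lists \<open>A\<close> first, then \<open>B - A\<close>, then the rest. Taking
  \<open>A = B\<close> counts the permutations through a single set.\<close>

lemma card_permutations_through:
  assumes S: "finite S" and AB: "A \<subseteq> B" "B \<subseteq> S"
  shows "card {xs \<in> permutations_of_set S. A \<in> prefixes_of xs \<and> B \<in> prefixes_of xs}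
    = fact (card A) * fact (card B - card A) * fact (card S - card B)"
proof -
  let ?P = permutations_of_set
  let ?T = "?P A \<times> ?P (B - A) \<times> ?P (S - B)"
  let ?f = "\<lambda>(x, y, z). x @ y @ z"
  have fin: "finite A" "finite B"
    using finite_subset[OF AB(2) S] finite_subset[OF AB(1)] by auto
  have "{xs \<in> ?P S. A \<in> prefixes_of xs \<and> B \<in> prefixes_of xs} = ?f ` ?T"
  proof (intro equalityI subsetI)
    fix xs assume "xs \<in> {xs \<in> ?P S. A \<in> prefixes_of xs \<and> B \<in> prefixes_of xs}"
    then obtain i j where xs: "set xs = S" "distinct xs" and i: "i \<le> length xs" "A = set (take i xs)"
      and j: "j \<le> length xs" "B = set (take j xs)"
      by (auto simp: prefixes_of_def permutations_of_set_def)
    have "card A = i" "card B = j" using i j xs by (simp_all add: distinct_card)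
    then have "i \<le> j" using AB(1) fin card_mono by blast
    have d: "xs = take i xs @ drop i (take j xs) @ drop j xs"
      using \<open>i \<le> j\<close> by (metis append.assoc append_take_drop_id min_absorb1 take_take)
    have "distinct (take i xs @ drop i (take j xs) @ drop j xs)" using xs(2) d by metis
    moreover have "take j xs = take i xs @ drop i (take j xs)"
      using \<open>i \<le> j\<close> by (metis append_take_drop_id min_absorb1 take_take)
    then have "B = A \<union> set (drop i (take j xs))" using i j by (metis set_append)
    moreover have "S = B \<union> set (drop j xs)" using xs j by (metis append_take_drop_id set_append)
    ultimately have "(take i xs, drop i (take j xs), drop j xs) \<in> ?T"
      using i j by (auto simp: permutations_of_set_def)
    then show "xs \<in> ?f ` ?T" using d by (metis (mono_tags, lifting) case_prod_conv image_eqI)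
  next
    fix xs assume "xs \<in> ?f ` ?T"
    then obtain x y z where xyz: "xs = x @ y @ z" "set x = A" "distinct x" "set y = B - A" "distinct y"
      "set z = S - B" "distinct z" by (auto simp: permutations_of_set_def)
    have "A = set (take (length x) xs)" "B = set (take (length (x @ y)) xs)"
      using xyz AB by auto
    then have "A \<in> prefixes_of xs" "B \<in> prefixes_of xs"
      unfolding prefixes_of_def using xyz(1)
      by (metis (mono_tags, lifting) CollectI append.assoc length_append le_add1)+
    then show "xs \<in> {xs \<in> ?P S. A \<in> prefixes_of xs \<and> B \<in> prefixes_of xs}"
      using xyz AB by (auto simp: permutations_of_set_def)
  qed
  \<comment> \<open>The three blocks have prescribed lengths, so a concatenation determines
    them.\<close>
  moreover have "inj_on ?f ?T"
  proof (rule inj_onI)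
    fix t t' assume *: "t \<in> ?T" "t' \<in> ?T" "?f t = ?f t'"
    obtain x y z x' y' z' where t: "t = (x, y, z)" "t' = (x', y', z')" by (metis prod_cases3)
    have "length x = length x'" "length y = length y'"
      using * t by (auto dest!: length_finite_permutations_of_set)
    then show "t = t'" using * t by simp
  qed
  ultimately have "card {xs \<in> ?P S. A \<in> prefixes_of xs \<and> B \<in> prefixes_of xs} = card ?T"
    by (simp add: card_image)
  then show ?thesis
    using S fin AB by (simp add: card_cartesian_product card_Diff_subset)
qed

section \<open>Comparable pairs on a single chain\<close>

text \<open>Only the top \<open>L\<close> members qualify: if \<open>A\<close> is the smallest one
  that does, all the others lie above \<open>A\<close>, so there are fewer than \<open>L\<close> of
  them.\<close>

lemma card_few_above:
  assumes fin: "finite K" and chain: "\<And>A B. A \<in> K \<Longrightarrow> B \<in> K \<Longrightarrow> A \<subseteq> B \<or> B \<subseteq> A"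
  shows "card {A \<in> K. card {B \<in> K. A \<subset> B} < L} \<le> L"
proof (rule ccontr)
  let ?T = "{A \<in> K. card {B \<in> K. A \<subset> B} < L}"
  assume "\<not> card ?T \<le> L"
  then have T: "L < card ?T" "finite ?T" using fin by (simp_all add: not_le)
  then have ne: "?T \<noteq> {}" by (metis card.empty not_less_zero)
  obtain A where "A \<in> ?T" "\<forall>B\<in>?T. B \<subseteq> A \<longrightarrow> A = B"
    using finite_has_minimal[OF T(2) ne] by (elim bexE)
  note A = this(1) this(2)[rule_format]
  then have "?T - {A} \<subseteq> {B \<in> K. A \<subset> B}" using chain by blast
  then have "card (?T - {A}) \<le> card {B \<in> K. A \<subset> B}" using fin by (intro card_mono) auto
  then show False using A(1) T by auto
qed

lemma card_few_below:
  assumes fin: "finite K" and chain: "\<And>A B. A \<in> K \<Longrightarrow> B \<in> K \<Longrightarrow> A \<subseteq> B \<or> B \<subseteq> A"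
  shows "card {A \<in> K. card {B \<in> K. B \<subset> A} < L} \<le> L"
proof (rule ccontr)
  let ?T = "{A \<in> K. card {B \<in> K. B \<subset> A} < L}"
  assume "\<not> card ?T \<le> L"
  then have T: "L < card ?T" "finite ?T" using fin by (simp_all add: not_le)
  then have ne: "?T \<noteq> {}" by (metis card.empty not_less_zero)
  obtain A where "A \<in> ?T" "\<forall>B\<in>?T. A \<subseteq> B \<longrightarrow> A = B"
    using finite_has_maximal[OF T(2) ne] by (elim bexE)
  note A = this(1) this(2)[rule_format]
  then have "?T - {A} \<subseteq> {B \<in> K. B \<subset> A}" using chain by blast
  then have "card (?T - {A}) \<le> card {B \<in> K. B \<subset> A}" using fin by (intro card_mono) auto
  then show False using A(1) T by auto
qed

text \<open>All but \<open>L\<close> members of \<open>U\<close> have at least \<open>L\<close>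
  members above them, and all but \<open>L\<close> members of \<open>D\<close> have at least
  \<open>L\<close> below; each of these contributes \<open>L\<close> pairs. An empty
  \<open>D\<close> saves one loss of \<open>L\<close>, and this is the origin of the constants 1 and
  2 of the theorem.\<close>

lemma chain_pairs_lower:
  assumes fin: "finite K" and chain: "\<And>A B. A \<in> K \<Longrightarrow> B \<in> K \<Longrightarrow> A \<subseteq> B \<or> B \<subseteq> A"
    and K: "K = U \<union> D" "U \<inter> D = {}"
  shows "real L * (real (card K) - (if D = {} then 1 else 2) * real L)
    \<le> real ((\<Sum>A\<in>U. card {B \<in> K. A \<subset> B}) + (\<Sum>A\<in>D. card {B \<in> K. B \<subset> A}))"
proof -
  let ?u = "\<lambda>A. card {B \<in> K. A \<subset> B}" and ?d = "\<lambda>A. card {B \<in> K. B \<subset> A}"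
  have finUD: "finite U" "finite D" using fin K by auto
  have "L * card {A \<in> U. L \<le> ?u A} \<le> (\<Sum>A\<in>{A \<in> U. L \<le> ?u A}. ?u A)"
    using sum_bounded_below[of "{A \<in> U. L \<le> ?u A}" L ?u] by (simp add: mult.commute)
  also have "\<dots> \<le> (\<Sum>A\<in>U. ?u A)" using finUD by (intro sum_mono2) auto
  finally have 1: "L * card {A \<in> U. L \<le> ?u A} \<le> (\<Sum>A\<in>U. ?u A)" .
  have "L * card {A \<in> D. L \<le> ?d A} \<le> (\<Sum>A\<in>{A \<in> D. L \<le> ?d A}. ?d A)"
    using sum_bounded_below[of "{A \<in> D. L \<le> ?d A}" L ?d] by (simp add: mult.commute)
  also have "\<dots> \<le> (\<Sum>A\<in>D. ?d A)" using finUD by (intro sum_mono2) auto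
  finally have 2: "L * card {A \<in> D. L \<le> ?d A} \<le> (\<Sum>A\<in>D. ?d A)" .
  have "card U \<le> card {A \<in> U. L \<le> ?u A} + card {A \<in> K. ?u A < L}"
    using finUD fin K by (intro order_trans[OF card_mono card_Un_le]) auto
  then have u: "card U \<le> card {A \<in> U. L \<le> ?u A} + L"
    using card_few_above[OF fin chain, of L] by linarith
  have "card D \<le> card {A \<in> D. L \<le> ?d A} + card {A \<in> K. ?d A < L}"
    using finUD fin K by (intro order_trans[OF card_mono card_Un_le]) auto
  then have d: "card D \<le> card {A \<in> D. L \<le> ?d A} + L"
    using card_few_below[OF fin chain, of L] by linarith
  have "card K = card U + card D" using K finUD card_Un_disjoint by blast
  then have "real (card K) - (if D = {} then 1 else 2) * real L \<le>
      real (card {A \<in> U. L \<le> ?u A} + card {A \<in> D. L \<le> ?d A})"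
    using u d by auto
  then have "real L * (real (card K) - (if D = {} then 1 else 2) * real L) \<le>
      real L * real (card {A \<in> U. L \<le> ?u A} + card {A \<in> D. L \<le> ?d A})"
    by (intro mult_left_mono) auto
  also have "\<dots> = real (L * card {A \<in> U. L \<le> ?u A} + L * card {A \<in> D. L \<le> ?d A})"
    by (simp add: algebra_simps)
  also have "\<dots> \<le> real ((\<Sum>A\<in>U. ?u A) + (\<Sum>A\<in>D. ?d A))"
    using 1 2 by (intro of_nat_mono add_mono)
  finally show ?thesis .
qed

section \<open>Double counting over random maximal chains\<close>

text \<open>Both sides count the triples \<open>(x, A, B)\<close> with \<open>Q A x\<close>,
  \<open>Q B x\<close> and \<open>R A B\<close>.\<close>

lemma sum_card_pairs_swap:
  assumes "finite P" "finite U" "finite C"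
  shows "(\<Sum>x\<in>P. \<Sum>A\<in>{A \<in> U. Q A x}. card {B \<in> {B \<in> C. Q B x}. R A B}) =
    (\<Sum>A\<in>U. \<Sum>B\<in>{B \<in> C. R A B}. card {x \<in> P. Q A x \<and> Q B x})"
proof -
  have "(\<Sum>x\<in>P. \<Sum>A\<in>{A \<in> U. Q A x}. card {B \<in> {B \<in> C. Q B x}. R A B}) =
     (\<Sum>x\<in>P. \<Sum>A\<in>U. \<Sum>B\<in>{B \<in> C. R A B}. if Q A x \<and> Q B x then 1 else 0)"
  proof (rule sum.cong[OF refl])
    fix x
    have "card {B \<in> {B \<in> C. Q B x}. R A B} = (\<Sum>B\<in>{B \<in> C. R A B}. if Q B x then 1 else 0)" for A
      using assms by (simp add: card_eq_sum sum.inter_filter[symmetric] conj_ac del: sum_constant One_nat_def)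
    then have "(\<Sum>A\<in>{A \<in> U. Q A x}. card {B \<in> {B \<in> C. Q B x}. R A B}) =
      (\<Sum>A\<in>U. if Q A x then (\<Sum>B\<in>{B \<in> C. R A B}. if Q B x then 1 else 0) else 0)"
      using assms by (simp only: sum.inter_filter)
    also have "\<dots> = (\<Sum>A\<in>U. \<Sum>B\<in>{B \<in> C. R A B}. if Q A x \<and> Q B x then 1 else 0)"
      by (intro sum.cong) auto
    finally show "(\<Sum>A\<in>{A \<in> U. Q A x}. card {B \<in> {B \<in> C. Q B x}. R A B}) =
      (\<Sum>A\<in>U. \<Sum>B\<in>{B \<in> C. R A B}. if Q A x \<and> Q B x then 1 else 0)" .
  qed
  also have "\<dots> = (\<Sum>A\<in>U. \<Sum>x\<in>P. \<Sum>B\<in>{B \<in> C. R A B}. if Q A x \<and> Q B x then 1 else 0)"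
    by (rule sum.swap)
  also have "\<dots> = (\<Sum>A\<in>U. \<Sum>B\<in>{B \<in> C. R A B}. \<Sum>x\<in>P. if Q A x \<and> Q B x then 1 else 0)"
    by (intro sum.cong refl sum.swap)
  also have "\<dots> = (\<Sum>A\<in>U. \<Sum>B\<in>{B \<in> C. R A B}. card {x \<in> P. Q A x \<and> Q B x})"
    using assms by (simp add: card_eq_sum sum.inter_filter del: sum_constant One_nat_def)
  finally show ?thesis .
qed

lemma sum_card_swap:
  assumes "finite P" "finite C"
  shows "(\<Sum>x\<in>P. card {A \<in> C. Q A x}) = (\<Sum>A\<in>C. card {x \<in> P. Q A x})"
proof -
  have "(\<Sum>x\<in>P. card {A \<in> C. Q A x}) = (\<Sum>x\<in>P. \<Sum>A\<in>C. if Q A x then 1 else 0)"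
    using assms by (simp add: card_eq_sum sum.inter_filter del: sum_constant One_nat_def)
  also have "\<dots> = (\<Sum>A\<in>C. \<Sum>x\<in>P. if Q A x then 1 else 0)" by (rule sum.swap)
  also have "\<dots> = (\<Sum>A\<in>C. card {x \<in> P. Q A x})"
    using assms by (simp add: card_eq_sum sum.inter_filter del: sum_constant One_nat_def)
  finally show ?thesis .
qed

text \<open>
  The expected number of comparable pairs of \<open>C\<close> on a uniformly random maximal chain, bounded from
  both sides. The chain through a permutation consists of the sets of its prefixes.
\<close>

lemma random_chain_count:
  fixes F :: real
  assumes S: "finite S" and CS: "C \<subseteq> Pow S" and C: "C = U \<union> D" "U \<inter> D = {}"
    and up: "\<And>v. v \<in> U \<Longrightarrow>
      (\<Sum>w\<in>{w \<in> C. v \<subset> w}. 1 / real ((card S - card v) choose (card w - card v))) \<le> F"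
    and down: "\<And>v. v \<in> D \<Longrightarrow> (\<Sum>w\<in>{w \<in> C. w \<subset> v}. 1 / real (card v choose card w)) \<le> F"
    and FL: "F \<le> real L"
  shows "(real L - F) * card C \<le> (if D = {} then 1 else 2) * (real L)\<^sup>2 * (card S choose (card S div 2))"
proof -
  define P where "P = permutations_of_set S"
  define n where "n = card S"
  define N where "N = real (n choose (n div 2))"
  define k :: real where "k = (if D = {} then 1 else 2)"
  \<comment> \<open>The number of permutations whose chain passes through \<open>A\<close>. Counts
    out of \<open>fact n\<close> stand in for probabilities throughout.\<close>
  define q :: "'a set \<Rightarrow> real" where "q A = fact (card A) * fact (n - card A)" for A
  let ?Q = "\<lambda>A xs. A \<in> prefixes_of xs"
  have finC: "finite C" using CS S finite_subset by blast
  then have finUD: "finite U" "finite D" using C by auto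
  have finP: "finite P" and cardP: "real (card P) = fact n"
    using S by (simp_all add: P_def n_def)
  have sub: "finite A" "card A \<le> n" if "A \<subseteq> S" for A
    using that S finite_subset card_mono by (auto simp: n_def)
  have q: "real (card {xs \<in> P. ?Q A xs}) = q A" if "A \<subseteq> S" for A
    using card_permutations_through[OF S order_refl that] by (simp add: P_def q_def n_def)
  have pair: "real (card {xs \<in> P. ?Q A xs \<and> ?Q B xs})
      = fact (card A) * fact (card B - card A) * fact (n - card B)" if "A \<subseteq> B" "B \<subseteq> S" for A B
    using card_permutations_through[OF S that] by (simp add: P_def n_def)
  \<comment> \<open>The second factor is the conditional probability that the chain meets
    \<open>B\<close>, given that it meets \<open>A\<close>.\<close>
  have pair_up: "real (card {xs \<in> P. ?Q A xs \<and> ?Q B xs}) =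
      q A * (1 / real ((n - card A) choose (card B - card A)))" if "A \<subseteq> B" "B \<subseteq> S" for A B
  proof -
    have "card A \<le> card B" using that sub card_mono by metis
    then show ?thesis
      using sub(2)[OF that(2)] unfolding pair[OF that] q_def
      by (subst binomial_fact) (auto simp: field_simps)
  qed
  have pair_down: "real (card {xs \<in> P. ?Q B xs \<and> ?Q A xs}) =
      q B * (1 / real (card B choose card A))" if "A \<subseteq> B" "B \<subseteq> S" for A B
  proof -
    have "card A \<le> card B" using that sub card_mono by metis
    then show ?thesis
      using sub(2)[OF that(2)] pair[OF that] unfolding q_def conj_commute[of "?Q B _"]
      by (subst binomial_fact) (auto simp: field_simps)
  qed
  \<comment> \<open>The LYM weight: a random chain meets \<open>A\<close> with probability at least
    \<open>1 / N\<close>.\<close>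
  have qN: "fact n \<le> N * q A" if "A \<subseteq> S" for A
  proof -
    have "fact n = q A * real (n choose card A)"
      using binomial_fact_lemma[OF sub(2)[OF that]] unfolding q_def
      by (metis of_nat_fact of_nat_mult)
    also have "\<dots> \<le> q A * N"
      unfolding N_def using binomial_maximum[of n "card A"]
      by (intro mult_left_mono) (auto simp: q_def)
    finally show ?thesis by (simp add: mult.commute)
  qed
  have q0: "0 \<le> q A" for A by (simp add: q_def)
  let ?K = "\<lambda>xs. {A \<in> C. ?Q A xs}"
  let ?u = "\<lambda>xs A. card {B \<in> ?K xs. A \<subset> B}" and ?d = "\<lambda>xs A. card {B \<in> ?K xs. B \<subset> A}"
  have "real L * (real (card (?K xs)) - k * real L) \<le>
      real ((\<Sum>A\<in>{A \<in> U. ?Q A xs}. ?u xs A) + (\<Sum>A\<in>{A \<in> D. ?Q A xs}. ?d xs A))" for xs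
  proof -
    \<comment> \<open>\<open>D\<close> can be nonempty while this chain misses it; the bound with
      \<open>k\<close> is then merely weaker.\<close>
    have "real L * (real (card (?K xs)) - k * real L) \<le>
      real L * (real (card (?K xs)) - (if {A \<in> D. ?Q A xs} = {} then 1 else 2) * real L)"
      unfolding k_def by (intro mult_left_mono diff_left_mono mult_right_mono) auto
    also have "\<dots> \<le> real ((\<Sum>A\<in>{A \<in> U. ?Q A xs}. ?u xs A) + (\<Sum>A\<in>{A \<in> D. ?Q A xs}. ?d xs A))"
      using finC C prefixes_of_chain[of _ xs] by (intro chain_pairs_lower) (simp, blast+)
    finally show ?thesis .
  qed
  then have "(\<Sum>xs\<in>P. real L * (real (card (?K xs)) - k * real L)) \<le>
      (\<Sum>xs\<in>P. real ((\<Sum>A\<in>{A \<in> U. ?Q A xs}. ?u xs A) + (\<Sum>A\<in>{A \<in> D. ?Q A xs}. ?d xs A)))"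
    by (intro sum_mono)
  also have "\<dots> = real (\<Sum>xs\<in>P. \<Sum>A\<in>{A \<in> U. ?Q A xs}. ?u xs A) +
      real (\<Sum>xs\<in>P. \<Sum>A\<in>{A \<in> D. ?Q A xs}. ?d xs A)"
    by (simp add: sum.distrib)
  also have "\<dots> = (\<Sum>A\<in>U. \<Sum>B\<in>{B \<in> C. A \<subset> B}. real (card {xs \<in> P. ?Q A xs \<and> ?Q B xs})) +
      (\<Sum>A\<in>D. \<Sum>B\<in>{B \<in> C. B \<subset> A}. real (card {xs \<in> P. ?Q A xs \<and> ?Q B xs}))"
    by (simp only: sum_card_pairs_swap finP finC finUD of_nat_sum)
  also have "\<dots> = (\<Sum>A\<in>U. q A * (\<Sum>B\<in>{B \<in> C. A \<subset> B}. 1 / real ((n - card A) choose (card B - card A)))) +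
      (\<Sum>A\<in>D. q A * (\<Sum>B\<in>{B \<in> C. B \<subset> A}. 1 / real (card A choose card B)))"
    unfolding sum_distrib_left using CS C
    by (intro arg_cong2[where f = "(+)"] sum.cong refl pair_up pair_down) auto
  also have "\<dots> \<le> (\<Sum>A\<in>U. q A * F) + (\<Sum>A\<in>D. q A * F)"
    using up down q0 by (intro add_mono sum_mono mult_left_mono) (auto simp: n_def)
  also have "\<dots> = F * (\<Sum>A\<in>C. q A)"
    unfolding C(1) using finUD C(2) by (simp add: sum.union_disjoint sum_distrib_left algebra_simps)
  finally have "(\<Sum>xs\<in>P. real L * (real (card (?K xs)) - k * real L)) \<le> F * (\<Sum>A\<in>C. q A)" .
  moreover have "(\<Sum>xs\<in>P. real L * (real (card (?K xs)) - k * real L)) =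
      real L * (real (\<Sum>xs\<in>P. card (?K xs)) - fact n * (k * real L))"
    by (simp add: sum_subtractf cardP flip: sum_distrib_left)
  moreover have "real (\<Sum>xs\<in>P. card (?K xs)) = (\<Sum>A\<in>C. q A)"
    unfolding sum_card_swap[OF finP finC] of_nat_sum using CS q by (intro sum.cong) auto
  ultimately have "(real L - F) * (\<Sum>A\<in>C. q A) \<le> k * (real L)\<^sup>2 * fact n"
    by (simp add: algebra_simps power2_eq_square)
  then have "N * ((real L - F) * (\<Sum>A\<in>C. q A)) \<le> N * (k * (real L)\<^sup>2 * fact n)"
    by (intro mult_left_mono) (auto simp: N_def)
  moreover have "fact n * real (card C) \<le> N * (\<Sum>A\<in>C. q A)"
    using sum_bounded_below[of C "fact n" "\<lambda>A. N * q A"] qN CS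
    by (simp add: sum_distrib_left subset_iff mult.commute)
  \<comment> \<open>Here \<open>F \<le> L\<close> matters: the factor must be nonnegative for the
    LYM lower bound to be inserted.\<close>
  then have "(real L - F) * (fact n * real (card C)) \<le> (real L - F) * (N * (\<Sum>A\<in>C. q A))"
    using FL by (intro mult_left_mono) auto
  ultimately have "fact n * ((real L - F) * real (card C)) \<le> fact n * (k * (real L)\<^sup>2 * N)"
    by (simp add: algebra_simps)
  then have "(real L - F) * real (card C) \<le> k * (real L)\<^sup>2 * N"
    by (subst (asm) mult_le_cancel_left_pos) (auto simp: fact_gt_zero)
  then show ?thesis by (simp add: k_def N_def n_def)
qed

section \<open>Sums of reciprocal binomial coefficients\<close>

text \<open>Grouping by \<open>h w = d\<close>, each fibre contributes its size over
  \<open>m choose d\<close>. The two bounds on that size give the two arguments of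
  \<open>min\<close>.\<close>

lemma sum_inverse_choose_le:
  assumes "finite W" and J: "finite J" "h ` W \<subseteq> J" "\<And>d. d \<in> J \<Longrightarrow> d \<le> m"
    and fibre: "\<And>d. d \<in> J \<Longrightarrow> real (card {w \<in> W. h w = d}) \<le> \<Delta>"
      "\<And>d. d \<in> J \<Longrightarrow> card {w \<in> W. h w = d} \<le> m choose d"
  shows "(\<Sum>w\<in>W. 1 / real (m choose h w)) \<le> (\<Sum>d\<in>J. min 1 (\<Delta> / real (m choose d)))"
proof -
  have "(\<Sum>w\<in>W. 1 / real (m choose h w)) = (\<Sum>d\<in>J. \<Sum>w\<in>{w \<in> W. h w = d}. 1 / real (m choose h w))"
    using assms by (intro sum.group[symmetric]) auto
  also have "\<dots> = (\<Sum>d\<in>J. real (card {w \<in> W. h w = d}) / real (m choose d))"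
    by (intro sum.cong) auto
  also have "\<dots> \<le> (\<Sum>d\<in>J. min 1 (\<Delta> / real (m choose d)))"
  proof (intro sum_mono)
    fix d assume d: "d \<in> J"
    then have "0 < real (m choose d)" using J(3) by simp
    then show "real (card {w \<in> W. h w = d}) / real (m choose d) \<le> min 1 (\<Delta> / real (m choose d))"
      using fibre[OF d] by (simp add: divide_right_mono)
  qed
  finally show ?thesis .
qed

text \<open>Unimodality and symmetry: the hypotheses place \<open>d\<close> between \<open>j\<close>
  and \<open>m - j\<close>, and a \<open>d\<close> beyond the middle is reflected to
  \<open>m - d\<close>.\<close>

lemma choose_le_choose:
  assumes "j \<le> d" "d + j \<le> m"
  shows "m choose j \<le> m choose d"
proof (cases "2 * d \<le> m")
  case True
  then show ?thesis using assms by (intro binomial_mono) auto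
next
  case False
  then have "m choose j \<le> m choose (m - d)" using assms by (intro binomial_mono) auto
  then show ?thesis using assms binomial_symmetric[of d m] by simp
qed

text \<open>Distances below \<open>j\<close> are kept. For the others
  \<open>m - d \<ge> n / 4 \<ge> j\<close>, hence \<open>m choose d\<close> is at least
  \<open>m choose j\<close>, which is at least \<open>(m / j) ^ j\<close> and so at least
  \<open>(n / (4 * j)) ^ j\<close>; there are at most \<open>n\<close> such
  \<open>d\<close>.\<close>

lemma sum_min_choose_le:
  fixes \<Delta> :: real
  assumes n: "n \<le> 4 * m" "m \<le> n" "4 * j \<le> n" and j: "1 \<le> j" and \<Delta>: "0 \<le> \<Delta>"
  shows "(\<Sum>d\<in>{d. 1 \<le> d \<and> d \<le> m \<and> n \<le> 4 * (m - d)}. min 1 (\<Delta> / real (m choose d)))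
    \<le> (\<Sum>d\<in>{1..<j}. min 1 (\<Delta> / real (m choose d))) + real n * (\<Delta> * (4 * real j / real n) ^ j)"
proof -
  let ?J = "{d. 1 \<le> d \<and> d \<le> m \<and> n \<le> 4 * (m - d)}"
  let ?g = "\<lambda>d. min 1 (\<Delta> / real (m choose d))"
  have n0: "0 < n" using n j by linarith
  have fin: "finite ?J" by (rule finite_subset[of _ "{..m}"]) auto
  have "(\<Sum>d\<in>?J. ?g d) \<le> (\<Sum>d\<in>{1..<j} \<union> {d \<in> ?J. j \<le> d}. ?g d)"
    using fin \<Delta> by (intro sum_mono2) auto
  also have "\<dots> = (\<Sum>d\<in>{1..<j}. ?g d) + (\<Sum>d\<in>{d \<in> ?J. j \<le> d}. ?g d)"
    using fin by (intro sum.union_disjoint) auto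
  also have "(\<Sum>d\<in>{d \<in> ?J. j \<le> d}. ?g d) \<le> (\<Sum>d\<in>{d \<in> ?J. j \<le> d}. \<Delta> * (4 * real j / real n) ^ j)"
  proof (intro sum_mono)
    fix d assume d: "d \<in> {d \<in> ?J. j \<le> d}"
    have "(real n / (4 * real j)) ^ j \<le> (real m / real j) ^ j"
      using n j n0 by (intro power_mono) (auto simp: field_simps)
    also have "\<dots> \<le> real (m choose j)" 
      using binomial_ge_n_over_k_pow_k[of j m, where 'a = real] d by auto
    also have "\<dots> \<le> real (m choose d)"
      using d n by (intro of_nat_mono choose_le_choose) auto
    finally have "\<Delta> / real (m choose d) \<le> \<Delta> / (real n / (4 * real j)) ^ j"
      using \<Delta> n0 j d by (intro divide_left_mono mult_pos_pos) auto
    also have "\<dots> = \<Delta> * (4 * real j / real n) ^ j" by (simp add: power_divide)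
    finally show "?g d \<le> \<Delta> * (4 * real j / real n) ^ j" by linarith
  qed
  also have "\<dots> = real (card {d \<in> ?J. j \<le> d}) * (\<Delta> * (4 * real j / real n) ^ j)" by simp
  also have "\<dots> \<le> real n * (\<Delta> * (4 * real j / real n) ^ j)"
  proof (intro mult_right_mono)
    have "card {d \<in> ?J. j \<le> d} \<le> card {1..m}" by (intro card_mono) auto
    then show "real (card {d \<in> ?J. j \<le> d}) \<le> real n" using n by simp
  qed (use \<Delta> in auto)
  finally show ?thesis by simp
qed

section \<open>Layers around a set and the resulting size bounds\<close>

definition up_layer :: "'a set set \<Rightarrow> 'a set \<Rightarrow> nat \<Rightarrow> 'a set set" where
  "up_layer C v d = {w \<in> C. v \<subset> w \<and> card w = card v + d}"

definition down_layer :: "'a set set \<Rightarrow> 'a set \<Rightarrow> nat \<Rightarrow> 'a set set" where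
  "down_layer C v d = {w \<in> C. w \<subset> v \<and> card v = card w + d}"

text \<open>
  Restricting to the middle layers keeps the binomial coefficients \<open>m choose d\<close> with \<open>2 \<le> d\<close> of
  quadratic size: without it \<open>d\<close> close to \<open>m\<close> would make them small again.
\<close>

definition middle :: "'a set \<Rightarrow> 'a set set" where
  "middle S = {A \<in> Pow S. card S \<le> 4 * card A \<and> 4 * card A \<le> 3 * card S}"

text \<open>Reduces to \<open>random_chain_count\<close> by grouping comparable sets by distance,
  the fibres being the layers. In both directions \<open>m - d\<close> is the size of the other set
  or of its complement, so membership in \<open>middle\<close> makes it at least a quarter of
  \<open>card S\<close>.\<close>

lemma supersaturation:
  fixes F \<Delta> :: real
  assumes S: "finite S" and CS: "C \<subseteq> middle S" and C: "C = U \<union> D" "U \<inter> D = {}"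
    and up: "\<And>v d. v \<in> U \<Longrightarrow> card (up_layer C v d) \<le> \<Delta>"
    and down: "\<And>v d. v \<in> D \<Longrightarrow> card (down_layer C v d) \<le> \<Delta>"
    and F: "\<And>m. card S \<le> 4 * m \<Longrightarrow> m \<le> card S \<Longrightarrow>
      (\<Sum>d\<in>{d. 1 \<le> d \<and> d \<le> m \<and> card S \<le> 4 * (m - d)}. min 1 (\<Delta> / real (m choose d))) \<le> F"
    and FL: "F \<le> real L"
  shows "(real L - F) * card C \<le> (if D = {} then 1 else 2) * (real L)\<^sup>2 * (card S choose (card S div 2))"
proof (rule random_chain_count[OF S _ C])
  define n where "n = card S"
  let ?J = "\<lambda>m. {d. 1 \<le> d \<and> d \<le> m \<and> n \<le> 4 * (m - d)}"
  show CP: "C \<subseteq> Pow S" using CS by (auto simp: middle_def)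
  have finC: "finite C" using CP S finite_subset by blast
  have finJ: "finite (?J m)" for m by (rule finite_subset[of _ "{..m}"]) auto
  have mid: "A \<subseteq> S" "finite A" "n \<le> 4 * card A" "4 * card A \<le> 3 * n" "card A \<le> n" if "A \<in> C" for A
    using CS that finite_subset[OF _ S, of A] card_mono[OF S, of A] by (auto simp: middle_def n_def)
  fix v
  show "(\<Sum>w\<in>{w \<in> C. v \<subset> w}. 1 / real ((card S - card v) choose (card w - card v))) \<le> F"
    if "v \<in> U"
  proof -
    have v: "v \<in> C" using that C by blast
    let ?W = "{w \<in> C. v \<subset> w}"
    have less: "card v < card w" if "w \<in> ?W" for w using that psubset_card_mono[OF mid(2)] by blast
    have fib: "{w \<in> ?W. card w - card v = d} = up_layer C v d" for d
    proof -
      have "card w - card v = d \<longleftrightarrow> card w = card v + d" if "w \<in> ?W" for w using less[OF that] by auto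
      then show ?thesis by (auto simp: up_layer_def)
    qed
    have "(\<Sum>w\<in>?W. 1 / real ((n - card v) choose (card w - card v))) \<le>
      (\<Sum>d\<in>?J (n - card v). min 1 (\<Delta> / real ((n - card v) choose d)))"
    proof (rule sum_inverse_choose_le[OF _ finJ])
      show "(\<lambda>w. card w - card v) ` ?W \<subseteq> ?J (n - card v)"
      proof (rule image_subsetI)
        fix w assume w: "w \<in> ?W"
        then show "card w - card v \<in> ?J (n - card v)" using less[OF w] mid[of w] by auto
      qed
    next
      fix d assume "d \<in> ?J (n - card v)"
      show "real (card {w \<in> ?W. card w - card v = d}) \<le> \<Delta>" unfolding fib using up that by blast
      \<comment> \<open>Subtracting \<open>v\<close> embeds the layer into the
        \<open>d\<close>-subsets of \<open>S - v\<close>.\<close>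
      have "(\<lambda>w. w - v) ` up_layer C v d \<subseteq> {B. B \<subseteq> S - v \<and> card B = d}"
        using mid v by (auto simp: up_layer_def card_Diff_subset)
      moreover have "inj_on (\<lambda>w. w - v) (up_layer C v d)"
        unfolding up_layer_def by (intro inj_onI) blast
      ultimately have "card (up_layer C v d) \<le> card {B. B \<subseteq> S - v \<and> card B = d}"
        using S by (intro card_inj_on_le) auto
      also have "\<dots> = (n - card v) choose d"
        using S mid[OF v] by (simp add: n_subsets card_Diff_subset n_def)
      finally show "card {w \<in> ?W. card w - card v = d} \<le> (n - card v) choose d" unfolding fib .
    qed (use finC in auto)
    also have "\<dots> \<le> F"
      using F[of "n - card v"] mid[OF v] by (simp add: n_def)
    finally show ?thesis by (simp add: n_def)
  qed
  show "(\<Sum>w\<in>{w \<in> C. w \<subset> v}. 1 / real (card v choose card w)) \<le> F" if "v \<in> D"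
  proof -
    have v: "v \<in> C" using that C by blast
    let ?W = "{w \<in> C. w \<subset> v}"
    have less: "card w < card v" if "w \<in> ?W" for w using that psubset_card_mono[OF mid(2)[OF v]] by blast
    have fib: "{w \<in> ?W. card v - card w = d} = down_layer C v d" if "1 \<le> d" for d
      using less that by (auto simp: down_layer_def)
    \<comment> \<open>Reflecting the coefficient indexes the downward sum by distance, like the
      upward one.\<close>
    have "(\<Sum>w\<in>?W. 1 / real (card v choose card w)) = (\<Sum>w\<in>?W. 1 / real (card v choose (card v - card w)))"
      using less by (intro sum.cong refl) (metis binomial_symmetric less_imp_le)
    also have "\<dots> \<le> (\<Sum>d\<in>?J (card v). min 1 (\<Delta> / real (card v choose d)))"
    proof (rule sum_inverse_choose_le[OF _ finJ])
      show "(\<lambda>w. card v - card w) ` ?W \<subseteq> ?J (card v)"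
      proof (rule image_subsetI)
        fix w assume w: "w \<in> ?W"
        then show "card v - card w \<in> ?J (card v)" using less[OF w] mid[of w] by auto
      qed
    next
      fix d assume d: "d \<in> ?J (card v)"
      then have d1: "1 \<le> d" by simp
      show "real (card {w \<in> ?W. card v - card w = d}) \<le> \<Delta>" unfolding fib[OF d1] using down that by blast
      have "card (down_layer C v d) \<le> card {B. B \<subseteq> v \<and> card B = card v - d}"
        using mid[OF v] by (intro card_mono) (auto simp: down_layer_def)
      also have "\<dots> = card v choose d"
        using mid[OF v] d binomial_symmetric[of d "card v"] by (simp add: n_subsets)
      finally show "card {w \<in> ?W. card v - card w = d} \<le> card v choose d" unfolding fib[OF d1] .
    qed (use finC in auto)
    also have "\<dots> \<le> F"
      using F[of "card v"] mid[OF v] by (simp add: n_def)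
    finally show ?thesis .
  qed
qed (rule FL)

text \<open>The case \<open>L = 1\<close> and \<open>j = 2\<close>. Distance 1 contributes at most
  \<open>4 * \<delta>\<close>, because \<open>m \<ge> n / 4\<close>, and the larger distances at
  most \<open>n * (\<delta> * n) * (8 / n) ^ 2 = 64 * \<delta>\<close>, where
  \<open>n = card S\<close>.\<close>

lemma supersaturation_linear:
  fixes \<delta> :: real
  assumes S: "finite S" "8 \<le> card S" and CS: "C \<subseteq> middle S" and C: "C = U \<union> D" "U \<inter> D = {}"
    and up: "\<And>v d. v \<in> U \<Longrightarrow> card (up_layer C v d) \<le> \<delta> * card S"
    and down: "\<And>v d. v \<in> D \<Longrightarrow> card (down_layer C v d) \<le> \<delta> * card S"
    and \<delta>: "0 \<le> \<delta>" "68 * \<delta> \<le> 1"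
  shows "(1 - 68 * \<delta>) * card C \<le> (if D = {} then 1 else 2) * real (card S choose (card S div 2))"
proof -
  define n where "n = card S"
  have "(real 1 - 68 * \<delta>) * card C \<le> (if D = {} then 1 else 2) * (real 1)\<^sup>2 * (card S choose (card S div 2))"
  proof (rule supersaturation[OF S(1) CS C up down])
    fix m assume m: "card S \<le> 4 * m" "m \<le> card S"
    have "(\<Sum>d\<in>{d. 1 \<le> d \<and> d \<le> m \<and> card S \<le> 4 * (m - d)}. min 1 (\<delta> * card S / real (m choose d)))
      \<le> (\<Sum>d\<in>{1..<2}. min 1 (\<delta> * card S / real (m choose d))) + card S * (\<delta> * card S * (4 * real 2 / card S) ^ 2)"
      using S m \<delta> sum_min_choose_le[of "card S" m 2 "\<delta> * card S"] by simp
    also have "{1..<2::nat} = {1}" by auto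
    also have "(\<Sum>d\<in>{1}. min 1 (\<delta> * card S / real (m choose d))) \<le> \<delta> * card S / m" by simp
    also have "\<dots> \<le> \<delta> * 4"
      using m S \<delta> by (auto simp: divide_simps mult.assoc intro!: mult_left_mono)
    also have "card S * (\<delta> * card S * (4 * real 2 / card S) ^ 2) = 64 * \<delta>"
    proof -
      have "real (card S) \<noteq> 0" using S by linarith
      then show ?thesis by (simp add: field_simps eval_nat_numeral)
    qed
    finally show "(\<Sum>d\<in>{d. 1 \<le> d \<and> d \<le> m \<and> card S \<le> 4 * (m - d)}. min 1 (\<delta> * card S / real (m choose d)))
      \<le> 68 * \<delta>" by simp
  qed (use \<delta> in auto)
  then show ?thesis by simp
qed

text \<open>
  With \<open>\<Delta> = n\<^sup>3\<close> the three lowest distances contribute at most 1 each and the others at most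
  \<open>n * n\<^sup>3 * (16 / n)\<^sup>4 = 65536\<close> in total.
\<close>

lemma supersaturation_cubic:
  assumes S: "finite S" "16 \<le> card S" and CS: "C \<subseteq> middle S" and C: "C = U \<union> D" "U \<inter> D = {}"
    and up: "\<And>v d. v \<in> U \<Longrightarrow> card (up_layer C v d) \<le> real (card S) ^ 3"
    and down: "\<And>v d. v \<in> D \<Longrightarrow> card (down_layer C v d) \<le> real (card S) ^ 3"
  shows "card C \<le> 2 * 65540\<^sup>2 * real (card S choose (card S div 2))"
proof -
  \<comment> \<open>\<open>L\<close> is taken one larger than \<open>F = 65539\<close>, so the
    factor on the left is 1.\<close>
  have "(real 65540 - 65539) * card C \<le> (if D = {} then 1 else 2) * (real 65540)\<^sup>2 * (card S choose (card S div 2))"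
  proof (rule supersaturation[OF S(1) CS C up down])
    fix m assume m: "card S \<le> 4 * m" "m \<le> card S"
    have "(\<Sum>d\<in>{d. 1 \<le> d \<and> d \<le> m \<and> card S \<le> 4 * (m - d)}. min 1 (real (card S) ^ 3 / real (m choose d)))
      \<le> (\<Sum>d\<in>{1..<4}. min 1 (real (card S) ^ 3 / real (m choose d))) +
        card S * (real (card S) ^ 3 * (4 * real 4 / card S) ^ 4)"
      using S m sum_min_choose_le[of "card S" m 4 "real (card S) ^ 3"] by simp
    also have "(\<Sum>d\<in>{1..<4}. min 1 (real (card S) ^ 3 / real (m choose d))) \<le> (\<Sum>d\<in>{1..<4::nat}. 1)"
      by (intro sum_mono) simp
    also have "card S * (real (card S) ^ 3 * (4 * real 4 / card S) ^ 4) = 65536"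
    proof -
      have "real (card S) \<noteq> 0" using S by linarith
      then show ?thesis by (simp add: field_simps eval_nat_numeral)
    qed
    finally show "(\<Sum>d\<in>{d. 1 \<le> d \<and> d \<le> m \<and> card S \<le> 4 * (m - d)}. min 1 (real (card S) ^ 3 / real (m choose d)))
      \<le> 65539" by simp
  qed auto
  also have "\<dots> \<le> 2 * (real 65540)\<^sup>2 * (card S choose (card S div 2))"
    by (intro mult_right_mono) auto
  finally show ?thesis by simp
qed

section \<open>Binomial estimates\<close>

lemma finite_middle [simp]: "finite S \<Longrightarrow> finite (middle S)"
  by (simp add: middle_def)

text \<open>A Markov bound by counting: the weights \<open>2 ^ card A\<close> sum to
  \<open>3 ^ n\<close>, and a set larger than \<open>3 * n / 4\<close> weighs at least
  \<open>(5 / 3) ^ n\<close>. Complementation handles the small sets.\<close>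

lemma card_outside_middle_le:
  assumes S: "finite S"
  shows "real (card (Pow S - middle S)) \<le> 2 * (9 / 5) ^ card S"
proof -
  define n where "n = card S"
  let ?H = "{A \<in> Pow S. 3 * n < 4 * card A}" and ?L = "{A \<in> Pow S. 4 * card A < n}"
  have finP: "finite (Pow S)" using S by simp
  have "(\<lambda>A. S - A) ` ?L \<subseteq> ?H"
    using S card_mono[OF S] by (force simp: card_Diff_subset finite_subset n_def)
  moreover have "inj_on (\<lambda>A. S - A) ?L" by (intro inj_onI) blast
  ultimately have "card ?L \<le> card ?H" using S by (intro card_inj_on_le) auto
  moreover have "Pow S - middle S = ?H \<union> ?L" by (auto simp: middle_def n_def)
  ultimately have c: "card (Pow S - middle S) \<le> 2 * card ?H"
    using card_Un_le[of ?H ?L] by simp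
  have "real (card ?H) * (5 / 3) ^ n \<le> (\<Sum>A\<in>?H. 2 ^ card A)"
  proof (rule sum_bounded_below)
    fix A assume A: "A \<in> ?H"
    \<comment> \<open>Fourth powers avoid fractional exponents;
      \<open>(5 / 3) ^ 4 = 625 / 81\<close> is below 8.\<close>
    have "((5 / 3 :: real) ^ n) ^ 4 = ((5 / 3) ^ 4) ^ n"
      by (metis power_mult mult.commute)
    also have "\<dots> \<le> (2 ^ 3) ^ n" by (intro power_mono) (auto simp: power_divide)
    also have "\<dots> = 2 ^ (3 * n)" by (simp only: power_mult)
    also have "\<dots> \<le> 2 ^ (card A * 4)" using A by (intro power_increasing) auto
    also have "\<dots> = (2 ^ card A) ^ 4" by (simp only: power_mult)
    finally show "(5 / 3 :: real) ^ n \<le> 2 ^ card A" by (rule power_le_imp_le_base[of _ 3, simplified]) simp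
  qed
  also have "\<dots> \<le> (\<Sum>A\<in>Pow S. 2 ^ card A)"
    using S by (intro sum_mono2) auto
  also have "\<dots> = 3 ^ n"
    using prod_add[OF S, of "\<lambda>_. 2::real" "\<lambda>_. 1"] by (simp add: n_def)
  finally have "real (card ?H) \<le> (9 / 5) ^ n" by (simp add: power_divide field_simps flip: power_mult_distrib)
  then show ?thesis using c by (simp add: n_def)
qed

definition central :: "nat \<Rightarrow> real" where
  "central n = real (n choose (n div 2))"

lemma central_pos: "0 < central n"
  by (simp add: central_def)

lemma le_central: "real n \<le> central n"
  unfolding central_def using binomial_maximum[of n 1] by simp

lemma pow2_le_central: "2 ^ n \<le> (real n + 1) * central n"
proof -
  have "(2::nat) ^ n \<le> (\<Sum>k\<le>n. n choose (n div 2))"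
    unfolding choose_row_sum[symmetric] by (intro sum_mono binomial_maximum)
  then have "real (2 ^ n) \<le> real ((n + 1) * (n choose (n div 2)))"
    by (intro of_nat_mono) simp
  then show ?thesis by (simp add: central_def algebra_simps)
qed

text \<open>\<open>(9 / 5) ^ n\<close> is negligible against \<open>2 ^ n / (n + 1)\<close>, a lower
  bound for \<open>central n\<close>.\<close>

lemma card_outside_middle_small:
  assumes "0 < \<epsilon>"
  shows "\<forall>\<^sub>F n in sequentially. real (card (Pow {1..n} - middle {1..n})) \<le> \<epsilon> * central n"
proof -
  have "(\<lambda>n. 2 * (9 / 5) ^ n * ((real n + 1) / 2 ^ n)) \<longlonglongrightarrow> 0"
    by real_asymp
  then have "\<forall>\<^sub>F n in sequentially. 2 * (9 / 5) ^ n * ((real n + 1) / 2 ^ n) < \<epsilon>"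
    using assms by (rule order_tendstoD)
  then show ?thesis
  proof eventually_elim
    case (elim n)
    have "real (card (Pow {1..n} - middle {1..n})) \<le> 2 * (9 / 5) ^ n"
      using card_outside_middle_le[of "{1..n}"] by simp
    also have "\<dots> \<le> \<epsilon> * (2 ^ n / (real n + 1))"
      using elim by (simp add: field_simps)
    also have "\<dots> \<le> \<epsilon> * central n"
      using assms pow2_le_central[of n] by (intro mult_left_mono) (auto simp: field_simps)
    finally show ?case .
  qed
qed

text \<open>With \<open>k = n div 2\<close> the ratio of the two coefficients is
  \<open>(n - k) / (k + 1)\<close>, which is at least \<open>n / (n + 2)\<close>.\<close>

lemma central_Suc_ge:
  assumes "0 < \<epsilon>"
  shows "\<forall>\<^sub>F n in sequentially. (1 - \<epsilon>) * central n \<le> real (n choose Suc (n div 2))"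
proof -
  have "(\<lambda>n. 2 / (real n + 2)) \<longlonglongrightarrow> 0" by real_asymp
  then have "\<forall>\<^sub>F n in sequentially. 2 / (real n + 2) < \<epsilon>" using assms by (rule order_tendstoD)
  then show ?thesis
  proof eventually_elim
    case (elim n)
    define k where "k = n div 2"
    have "Suc k * (n choose Suc k) = (n - k) * (n choose k)"
      by (metis binomial_absorb_comp binomial_absorption mult.commute)
    then have "real (Suc k) * real (n choose Suc k) = real (n - k) * central n"
      unfolding central_def k_def by (metis of_nat_mult)
    moreover have "real (n - k) \<ge> (1 - 2 / (real n + 2)) * real (Suc k)"
    proof -
      have "(1 - 2 / (real n + 2)) * real (Suc k) \<le> (1 - 2 / (real n + 2)) * ((real n + 2) / 2)"
        by (intro mult_left_mono) (auto simp: k_def field_simps)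
      also have "\<dots> = real n / 2" by (simp add: field_simps)
      also have "\<dots> \<le> real (n - k)" by (simp add: k_def of_nat_diff)
      finally show ?thesis .
    qed
    ultimately have "real (Suc k) * real (n choose Suc k) \<ge> (1 - 2 / (real n + 2)) * real (Suc k) * central n"
      using central_pos[of n] by simp
    then have "real (Suc k) * ((1 - 2 / (real n + 2)) * central n) \<le> real (Suc k) * real (n choose Suc k)"
      by (simp only: mult_ac)
    then have "(1 - 2 / (real n + 2)) * central n \<le> real (n choose Suc k)"
      by (rule mult_left_le_imp_le) simp
    moreover have "(1 - \<epsilon>) * central n \<le> (1 - 2 / (real n + 2)) * central n"
      using elim central_pos[of n] by (intro mult_right_mono) auto
    ultimately show ?case by (simp add: k_def)
  qed
qed

section \<open>Forbidden posets and layers\<close>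

lemma hereditary_induced_free:
  assumes "fst P \<noteq> {}"
  shows "hereditary (induced_free P)"
proof
  show "induced_free P {}"
    using assms unfolding induced_free_def induced_copy_def by (auto dest!: bij_betw_imp_surj_on)
qed (auto simp: induced_free_def)

lemma not_induced_free_vee:
  assumes T: "T \<subseteq> G" "card T = k" "finite T" and v: "v \<in> G" "\<And>w. w \<in> T \<Longrightarrow> v \<subset> w"
    and anti: "\<And>w w'. w \<in> T \<Longrightarrow> w' \<in> T \<Longrightarrow> w \<subseteq> w' \<Longrightarrow> w = w'"
  shows "\<not> induced_free (vee k) G"
proof -
  obtain h where h: "bij_betw h {1..k} T" using ex_bij_betw_nat_finite_1[OF T(3)] T(2) by auto
  then have hT: "h j \<in> T" if "j \<in> {1..k}" for j using that bij_betwE by blast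
  have hinj: "h j = h j' \<Longrightarrow> j = j'" if "j \<in> {1..k}" "j' \<in> {1..k}" for j j'
    using that h by (auto simp: bij_betw_def dest: inj_onD)
  define i where "i x = (case x of Bottom \<Rightarrow> v | Upper j \<Rightarrow> h j)" for x
  have vh: "v \<subset> h j" if "j \<in> {1..k}" for j using v(2) hT that by blast
  have iff: "(x, y) \<in> snd (vee k) \<longleftrightarrow> i x \<subseteq> i y" if x: "x \<in> fst (vee k)" and y: "y \<in> fst (vee k)" for x y
  proof (cases x)
    case x': Bottom
    show ?thesis
    proof (cases y)
      case Bottom
      then show ?thesis using x' by (auto simp: vee_def Let_def i_def)
    next
      case y': (Upper b)
      then have b: "b \<in> {1..k}" using y by (auto simp: vee_def Let_def)
      then show ?thesis using x' y' vh[OF b] by (auto simp: vee_def Let_def i_def)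
    qed
  next
    case x': (Upper a)
    then have a: "a \<in> {1..k}" using x by (auto simp: vee_def Let_def)
    show ?thesis
    proof (cases y)
      case Bottom
      then show ?thesis using x' vh[OF a] by (auto simp: vee_def Let_def i_def)
    next
      case y': (Upper b)
      then have b: "b \<in> {1..k}" using y by (auto simp: vee_def Let_def)
      have "h a \<subseteq> h b \<longleftrightarrow> a = b" using anti[OF hT[OF a] hT[OF b]] hinj[OF a b] by auto
      then show ?thesis using x' y' a b by (auto simp: vee_def Let_def i_def)
    qed
  qed
  \<comment> \<open>Injectivity comes for free: the order equivalence transfers antisymmetry from
    the poset.\<close>
  have "inj_on i (fst (vee k))"
  proof (rule inj_onI)
    fix x y assume *: "x \<in> fst (vee k)" "y \<in> fst (vee k)" "i x = i y"
    then have "(x, y) \<in> snd (vee k)" "(y, x) \<in> snd (vee k)" using iff by auto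
    then show "x = y"
      using partial_order_vee[of k] by (auto simp: partial_order_on_def dest: antisymD)
  qed
  with iff have "induced_copy (vee k) (i ` fst (vee k))"
    unfolding induced_copy_def by (auto intro!: exI[of _ i] inj_on_imp_bij_betw)
  moreover have "i ` fst (vee k) \<subseteq> G" using T(1) v(1) hT by (auto simp: vee_def Let_def i_def)
  ultimately show ?thesis unfolding induced_free_def by blast
qed

lemma not_induced_free_K_poset:
  assumes A: "A \<subseteq> G" "card A = s" "finite A" and B: "B \<subseteq> G" "card B = t" "finite B"
    and v: "v \<in> G" "\<And>w. w \<in> A \<Longrightarrow> w \<subset> v" "\<And>w. w \<in> B \<Longrightarrow> v \<subset> w"
    and antiA: "\<And>w w'. w \<in> A \<Longrightarrow> w' \<in> A \<Longrightarrow> w \<subseteq> w' \<Longrightarrow> w = w'"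
    and antiB: "\<And>w w'. w \<in> B \<Longrightarrow> w' \<in> B \<Longrightarrow> w \<subseteq> w' \<Longrightarrow> w = w'"
  shows "\<not> induced_free (K_poset s t) G"
proof -
  let ?P = "K_poset s t"
  obtain g where g: "bij_betw g {1..s} A" using ex_bij_betw_nat_finite_1[OF A(3)] A(2) by auto
  obtain h where h: "bij_betw h {1..t} B" using ex_bij_betw_nat_finite_1[OF B(3)] B(2) by auto
  have gA: "g j \<in> A" if "j \<in> {1..s}" for j using that g bij_betwE by blast
  have hB: "h j \<in> B" if "j \<in> {1..t}" for j using that h bij_betwE by blast
  have ginj: "g j = g j' \<Longrightarrow> j = j'" if "j \<in> {1..s}" "j' \<in> {1..s}" for j j'
    using that g by (auto simp: bij_betw_def dest: inj_onD)
  have hinj: "h j = h j' \<Longrightarrow> j = j'" if "j \<in> {1..t}" "j' \<in> {1..t}" for j j'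
    using that h by (auto simp: bij_betw_def dest: inj_onD)
  define i where "i x = (case x of KA j \<Rightarrow> g j | KB \<Rightarrow> v | KC j \<Rightarrow> h j)" for x
  have gv: "g j \<subset> v" if "j \<in> {1..s}" for j using v(2) gA that by blast
  have vh: "v \<subset> h j" if "j \<in> {1..t}" for j using v(3) hB that by blast
  have iff: "(x, y) \<in> snd ?P \<longleftrightarrow> i x \<subseteq> i y" if x: "x \<in> fst ?P" and y: "y \<in> fst ?P" for x y
  proof (cases x)
    case x': (KA a)
    then have a: "a \<in> {1..s}" using x by (auto simp: K_poset_def Let_def)
    show ?thesis
    proof (cases y)
      case y': (KA b)
      then have b: "b \<in> {1..s}" using y by (auto simp: K_poset_def Let_def)
      have "g a \<subseteq> g b \<longleftrightarrow> a = b" using antiA[OF gA[OF a] gA[OF b]] ginj[OF a b] by auto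
      then show ?thesis using x' y' a b by (auto simp: K_poset_def Let_def i_def)
    next
      case KB
      then show ?thesis using x' a gv[OF a] by (auto simp: K_poset_def Let_def i_def)
    next
      case y': (KC b)
      then have b: "b \<in> {1..t}" using y by (auto simp: K_poset_def Let_def)
      then show ?thesis using x' y' a gv[OF a] vh[OF b] by (auto simp: K_poset_def Let_def i_def)
    qed
  next
    case x': KB
    show ?thesis
    proof (cases y)
      case y': (KA b)
      then have b: "b \<in> {1..s}" using y by (auto simp: K_poset_def Let_def)
      then show ?thesis using x' y' gv[OF b] by (auto simp: K_poset_def Let_def i_def)
    next
      case KB
      then show ?thesis using x' by (auto simp: K_poset_def Let_def i_def)
    next
      case y': (KC b)
      then have b: "b \<in> {1..t}" using y by (auto simp: K_poset_def Let_def)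
      then show ?thesis using x' y' vh[OF b] by (auto simp: K_poset_def Let_def i_def)
    qed
  next
    case x': (KC a)
    then have a: "a \<in> {1..t}" using x by (auto simp: K_poset_def Let_def)
    show ?thesis
    proof (cases y)
      case y': (KA b)
      then have b: "b \<in> {1..s}" using y by (auto simp: K_poset_def Let_def)
      then show ?thesis using x' y' vh[OF a] gv[OF b] by (auto simp: K_poset_def Let_def i_def)
    next
      case KB
      then show ?thesis using x' vh[OF a] by (auto simp: K_poset_def Let_def i_def)
    next
      case y': (KC b)
      then have b: "b \<in> {1..t}" using y by (auto simp: K_poset_def Let_def)
      have "h a \<subseteq> h b \<longleftrightarrow> a = b" using antiB[OF hB[OF a] hB[OF b]] hinj[OF a b] by auto
      then show ?thesis using x' y' a b by (auto simp: K_poset_def Let_def i_def)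
    qed
  qed
  have "inj_on i (fst ?P)"
  proof (rule inj_onI)
    fix x y assume *: "x \<in> fst ?P" "y \<in> fst ?P" "i x = i y"
    then have "(x, y) \<in> snd ?P" "(y, x) \<in> snd ?P" using iff by auto
    then show "x = y"
      using partial_order_K_poset[of s t] by (auto simp: partial_order_on_def dest: antisymD)
  qed
  with iff have "induced_copy ?P (i ` fst ?P)"
    unfolding induced_copy_def by (auto intro!: exI[of _ i] inj_on_imp_bij_betw)
  moreover have "i ` fst ?P \<subseteq> G" using A(1) B(1) v(1) gA hB by (auto simp: K_poset_def Let_def i_def)
  ultimately show ?thesis unfolding induced_free_def by blast
qed

lemma layer_antichain:
  assumes "card A = card B" "finite B" "A \<subseteq> B"
  shows "A = B"
  using assms card_subset_eq by metis

text \<open>Otherwise \<open>r + 1\<close> members of the layer, an antichain above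
  \<open>v\<close>, form a copy with \<open>v\<close> as bottom. This is the sparsity condition of
  \<open>splits\<close> with both sets equal.\<close>

lemma vee_free_up_layer:
  assumes fin: "\<And>A. A \<in> C \<Longrightarrow> finite A" and free: "induced_free (vee (r + 1)) G" and "v \<in> G"
  shows "card (G \<inter> up_layer C v d) \<le> r"
proof (rule ccontr)
  assume "\<not> card (G \<inter> up_layer C v d) \<le> r"
  then have "r + 1 \<le> card (G \<inter> up_layer C v d)" by simp
  then obtain T where T: "T \<subseteq> G \<inter> up_layer C v d" "card T = r + 1" "finite T"
    by (rule obtain_subset_with_card_n)
  have layer: "finite w" "card w = card v + d" if "w \<in> T" for w
    using that T(1) fin by (auto simp: up_layer_def)
  have anti: "w = w'" if "w \<in> T" "w' \<in> T" "w \<subseteq> w'" for w w'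
    using that layer by (intro layer_antichain) auto
  have "\<not> induced_free (vee (r + 1)) G"
    by (rule not_induced_free_vee[of T]) (use T \<open>v \<in> G\<close> anti in \<open>auto simp: up_layer_def\<close>)
  then show False using free by simp
qed

text \<open>\<open>s\<close> sets from a layer below \<open>v\<close> and \<open>t\<close> from a
  layer above it would form a copy with \<open>v\<close> in the middle. The bound
  \<open>s + t\<close> is generous; it covers both sides with the single parameter of
  \<open>splits\<close>.\<close>

lemma K_free_layers:
  assumes fin: "\<And>A. A \<in> C \<Longrightarrow> finite A" and free: "induced_free (K_poset s t) G" and "v \<in> G"
  shows "card (G \<inter> down_layer C v d') \<le> s + t \<or> card (G \<inter> up_layer C v d) \<le> s + t"
proof (rule ccontr)
  assume "\<not> ?thesis"
  then have "s \<le> card (G \<inter> down_layer C v d')" "t \<le> card (G \<inter> up_layer C v d)" by auto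
  then obtain A B where A: "A \<subseteq> G \<inter> down_layer C v d'" "card A = s" "finite A"
    and B: "B \<subseteq> G \<inter> up_layer C v d" "card B = t" "finite B"
    by (meson obtain_subset_with_card_n)
  have layerA: "finite w" "card w + d' = card v" if "w \<in> A" for w
    using that A(1) fin by (auto simp: down_layer_def)
  have antiA: "w = w'" if "w \<in> A" "w' \<in> A" "w \<subseteq> w'" for w w'
    using that layerA[of w] layerA[of w'] by (intro layer_antichain) auto
  have layerB: "finite w" "card w = card v + d" if "w \<in> B" for w
    using that B(1) fin by (auto simp: up_layer_def)
  have antiB: "w = w'" if "w \<in> B" "w' \<in> B" "w \<subseteq> w'" for w w'
    using that layerB by (intro layer_antichain) auto
  have "\<not> induced_free (K_poset s t) G"
    by (rule not_induced_free_K_poset[of A _ _ B])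
      (use A B \<open>v \<in> G\<close> antiA antiB in \<open>auto simp: up_layer_def down_layer_def\<close>)
  then show False using free by simp
qed

section \<open>Free families of one or two layers, for the lower bound\<close>

lemma induced_free_vee_layer:
  assumes fin: "\<And>A. A \<in> G \<Longrightarrow> finite A" and card: "\<And>A. A \<in> G \<Longrightarrow> card A = k"
  shows "induced_free (vee (r + 1)) G"
  unfolding induced_free_def induced_copy_def
proof (clarify)
  fix H i assume H: "H \<subseteq> G" "bij_betw i (fst (vee (r + 1))) H"
    and ord: "\<forall>x\<in>fst (vee (r + 1)). \<forall>y\<in>fst (vee (r + 1)). ((x, y) \<in> snd (vee (r + 1))) = (i x \<subseteq> i y)"
  have in_vee: "Bottom \<in> fst (vee (r + 1))" "Upper 1 \<in> fst (vee (r + 1))"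
    by (auto simp: vee_def Let_def)
  then have "i Bottom \<in> G" "i (Upper 1) \<in> G" using H bij_betwE by blast+
  moreover have "(Bottom, Upper 1) \<in> snd (vee (r + 1))" "(Upper 1, Bottom) \<notin> snd (vee (r + 1))"
    by (auto simp: vee_def Let_def)
  then have "i Bottom \<subset> i (Upper 1)" using ord in_vee by blast
  ultimately show False using fin card psubset_card_mono by (metis less_irrefl)
qed

text \<open>A copy contains a strict chain of three sets, hence three different sizes.\<close>

lemma induced_free_K_poset_layers:
  assumes fin: "\<And>A. A \<in> G \<Longrightarrow> finite A" and card: "\<And>A. A \<in> G \<Longrightarrow> card A \<in> {k, Suc k}"
    and st: "1 \<le> s" "1 \<le> t"
  shows "induced_free (K_poset s t) G"
  unfolding induced_free_def induced_copy_def
proof (clarify)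
  let ?P = "K_poset s t"
  fix H i assume H: "H \<subseteq> G" "bij_betw i (fst ?P) H"
    and ord: "\<forall>x\<in>fst ?P. \<forall>y\<in>fst ?P. ((x, y) \<in> snd ?P) = (i x \<subseteq> i y)"
  have in_P: "KA 1 \<in> fst ?P" "KB \<in> fst ?P" "KC 1 \<in> fst ?P"
    using st by (auto simp: K_poset_def Let_def)
  then have G: "i (KA 1) \<in> G" "i KB \<in> G" "i (KC 1) \<in> G" using H bij_betwE by blast+
  have "(KA 1, KB) \<in> snd ?P" "(KB, KA 1) \<notin> snd ?P" "(KB, KC 1) \<in> snd ?P" "(KC 1, KB) \<notin> snd ?P"
    using st by (auto simp: K_poset_def Let_def)
  then have "i (KA 1) \<subset> i KB" "i KB \<subset> i (KC 1)" using ord in_P by blast+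
  then have "card (i (KA 1)) < card (i KB)" "card (i KB) < card (i (KC 1))"
    using G fin psubset_card_mono by metis+
  then show False using card[OF G(1)] card[OF G(2)] card[OF G(3)] by auto
qed

section \<open>Asymptotics\<close>

text \<open>A diagonal argument: control at every fixed accuracy \<kappa> yields one null sequence,
  by letting the accuracy improve so slowly with \<open>n\<close> that the failure probability still
  vanishes.\<close>

lemma whp_asympI:
  assumes bad: "\<And>\<kappa>. 0 < \<kappa> \<Longrightarrow>
    (\<lambda>n. measure_pmf.prob (M n) {x. \<not> ((c - \<kappa>) * a n \<le> X n x \<and> X n x \<le> (c + \<kappa>) * a n)}) \<longlonglongrightarrow> 0"
  shows "whp_asymp M X c a"
proof -
  define good where "good \<kappa> n = {x. (c - \<kappa>) * a n \<le> X n x \<and> X n x \<le> (c + \<kappa>) * a n}" for \<kappa> n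
  define b where "b k n = measure_pmf.prob (M n) (- good (1 / real (Suc k)) n)" for k n
  \<comment> \<open>the best accuracy that the failure probability at \<open>n\<close> already permits; \<open>0\<close> is a fallback\<close>
  define K where "K n = Max {k \<in> {..n}. k = 0 \<or> b k n < 1 / real (Suc k)}" for n
  have K_in: "K n \<in> {k \<in> {..n}. k = 0 \<or> b k n < 1 / real (Suc k)}" for n
    unfolding K_def by (rule Max_in) auto
  have "\<forall>\<^sub>F n in sequentially. k \<le> K n" for k
  proof -
    have "b k \<longlonglongrightarrow> 0"
      using bad[of "1 / real (Suc k)"] unfolding b_def good_def Compl_eq mem_Collect_eq by simp
    then have "\<forall>\<^sub>F n in sequentially. b k n < 1 / real (Suc k)" by (rule order_tendstoD) simp
    with eventually_ge_at_top[of k] show ?thesis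
    proof eventually_elim
      case (elim n)
      then show ?case unfolding K_def by (intro Max_ge) auto
    qed
  qed
  then have "filterlim K at_top sequentially" unfolding filterlim_at_top by blast
  then have inv: "(\<lambda>n. 1 / real (Suc (K n))) \<longlonglongrightarrow> 0"
    by (rule filterlim_compose[OF LIMSEQ_Suc[OF lim_1_over_n]])
  have "(\<lambda>n. 1 - measure_pmf.prob (M n) (good (1 / real (Suc (K n))) n)) \<longlonglongrightarrow> 0"
  proof (rule tendsto_sandwich[OF _ _ tendsto_const inv])
    show "\<forall>\<^sub>F n in sequentially. 0 \<le> 1 - measure_pmf.prob (M n) (good (1 / real (Suc (K n))) n)"
      by (simp add: measure_pmf.prob_le_1)
    show "\<forall>\<^sub>F n in sequentially. 1 - measure_pmf.prob (M n) (good (1 / real (Suc (K n))) n)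
        \<le> 1 / real (Suc (K n))"
    proof (intro always_eventually allI)
      fix n
      have "1 - measure_pmf.prob (M n) (good (1 / real (Suc (K n))) n) = b (K n) n"
        using measure_pmf.prob_compl[of "good (1 / real (Suc (K n))) n" "M n"]
        by (simp add: b_def Compl_eq_Diff_UNIV)
      \<comment> \<open>In the fallback case \<open>K n = 0\<close> the right side is 1, a trivial
        bound for a probability.\<close>
      also have "\<dots> \<le> 1 / real (Suc (K n))"
        using K_in[of n] measure_pmf.prob_le_1 by (auto simp: b_def)
      finally show "1 - measure_pmf.prob (M n) (good (1 / real (Suc (K n))) n) \<le> 1 / real (Suc (K n))" .
    qed
  qed
  then have "(\<lambda>n. 1 - (1 - measure_pmf.prob (M n) (good (1 / real (Suc (K n))) n))) \<longlonglongrightarrow> 1 - 0"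
    by (intro tendsto_intros)
  then have "whp M (\<lambda>n x. (c - 1 / real (Suc (K n))) * a n \<le> X n x \<and> X n x \<le> (c + 1 / real (Suc (K n))) * a n)"
    by (simp add: whp_def good_def)
  moreover have "(\<lambda>n. 1 / real (Suc (K n))) \<in> o(\<lambda>_. 1)"
    using inv by (intro smalloI_tendsto) auto
  ultimately show ?thesis unfolding whp_asymp_def by blast
qed

text \<open>Markov's inequality for the exponential. With \<theta> on both sides of the event, a
  negative \<theta> yields the lower tail.\<close>

lemma prob_le_exp_moment:
  fixes f :: "'a set \<Rightarrow> real"
  assumes "finite V"
  shows "measure_pmf.prob (random_subset V p) {P. \<theta> * t \<le> \<theta> * f P}
    \<le> measure_pmf.expectation (random_subset V p) (\<lambda>P. exp (\<theta> * f P)) * exp (- \<theta> * t)"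
proof -
  have "measure_pmf.prob (random_subset V p) {P. \<theta> * t \<le> \<theta> * f P} =
      measure_pmf.expectation (random_subset V p) (indicator {P. \<theta> * t \<le> \<theta> * f P})"
    by simp
  also have "\<dots> \<le> measure_pmf.expectation (random_subset V p) (\<lambda>P. exp (\<theta> * f P) * exp (- \<theta> * t))"
    using assms by (intro integral_mono integrable_random_subset)
      (auto simp: indicator_def simp flip: exp_add)
  also have "\<dots> = measure_pmf.expectation (random_subset V p) (\<lambda>P. exp (\<theta> * f P)) * exp (- \<theta> * t)"
    by simp
  finally show ?thesis .
qed

lemma exp_le_quadratic:
  fixes \<theta> :: real
  assumes "0 \<le> \<theta>" "\<theta> \<le> 1"
  shows "exp \<theta> - 1 \<le> \<theta> + \<theta>\<^sup>2" and "exp (- \<theta>) - 1 \<le> - \<theta> + \<theta>\<^sup>2"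
proof -
  show "exp \<theta> - 1 \<le> \<theta> + \<theta>\<^sup>2" using exp_bound[OF assms] by simp
  \<comment> \<open>The product equals \<open>1 + \<theta> ^ 3\<close>.\<close>
  have "1 \<le> (1 + \<theta>) * (1 - \<theta> + \<theta>\<^sup>2)"
    using assms by (simp add: algebra_simps power2_eq_square)
  also have "\<dots> \<le> exp \<theta> * (1 - \<theta> + \<theta>\<^sup>2)"
    using assms by (intro mult_right_mono) (auto simp: add_nonneg_nonneg)
  finally show "exp (- \<theta>) - 1 \<le> - \<theta> + \<theta>\<^sup>2"
    by (simp add: exp_minus field_simps)
qed

lemma tendsto_exp_neg_mult:
  assumes "filterlim a at_top sequentially" "0 < (e::real)"
  shows "(\<lambda>n. exp (- e * a n)) \<longlonglongrightarrow> 0"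
proof -
  have "filterlim (\<lambda>n. e * a n) at_top sequentially"
    by (rule filterlim_tendsto_pos_mult_at_top[OF tendsto_const assms(2,1)])
  then show ?thesis
    by (intro filterlim_compose[OF exp_at_bot]) (simp add: filterlim_uminus_at_bot)
qed

section \<open>Tail bounds for the largest free subfamily\<close>

locale random_hereditary = hereditary free for free :: "nat set set \<Rightarrow> bool" +
  fixes p :: "nat \<Rightarrow> real" and c :: real
  assumes p: "0 \<le> p n" "p n \<le> 1"
    and pn: "filterlim (\<lambda>n. p n * real n) at_top sequentially"
    and c: "0 \<le> c"
begin

abbreviation scale :: "nat \<Rightarrow> real" where
  "scale n \<equiv> p n * central n"

lemma scale_at_top: "filterlim scale at_top sequentially"
  by (rule filterlim_at_top_mono[OF pn]) (auto intro!: always_eventually mult_left_mono le_central p)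

text \<open>The random family meets \<open>L n\<close> in a free family of binomial size, so the
  Chernoff lower tail of that size suffices.\<close>

lemma prob_largest_sub_small:
  assumes free: "\<And>n. free (L n)" and L: "\<And>n. L n \<subseteq> Pow {1..n}"
    and card: "\<And>\<epsilon>. 0 < \<epsilon> \<Longrightarrow> \<forall>\<^sub>F n in sequentially. (c - \<epsilon>) * central n \<le> card (L n)"
    and \<kappa>: "0 < \<kappa>"
  shows "(\<lambda>n. measure_pmf.prob (random_family n (p n))
    {F. largest_sub free F \<le> (c - \<kappa>) * scale n}) \<longlonglongrightarrow> 0"
proof -
  define \<epsilon> where "\<epsilon> = \<kappa> / 4"
  \<comment> \<open>Ensures \<open>\<theta> * c \<le> \<epsilon>\<close>: the quadratic error of the
    exponential then uses up only a quarter of \<kappa>.\<close>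
  define \<theta> where "\<theta> = min 1 (\<epsilon> / (c + 1))"
  have \<epsilon>: "0 < \<epsilon>" and \<theta>: "0 < \<theta>" "\<theta> \<le> 1" using \<kappa> c by (auto simp: \<epsilon>_def \<theta>_def)
  have \<theta>c: "\<theta> * c \<le> \<epsilon>"
  proof -
    have "\<theta> * c \<le> \<epsilon> / (c + 1) * (c + 1)" using \<theta> \<epsilon> c by (intro mult_mono) (auto simp: \<theta>_def)
    then show ?thesis using c by simp
  qed
  have "\<forall>\<^sub>F n in sequentially. measure_pmf.prob (random_family n (p n))
    {F. largest_sub free F \<le> (c - \<kappa>) * scale n} \<le> exp (- (\<theta> * \<epsilon>) * scale n)"
    using card[OF \<epsilon>]
  proof eventually_elim
    case (elim n)
    define t where "t = (c - \<kappa>) * scale n"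
    have finL: "finite (L n)" using L finite_subset by blast
    have "measure_pmf.prob (random_family n (p n)) {F. largest_sub free F \<le> t} \<le>
        measure_pmf.prob (random_family n (p n)) {F. - \<theta> * t \<le> - \<theta> * card (F \<inter> L n)}"
    proof (rule measure_pmf.finite_measure_mono_AE)
      show "AE F in measure_pmf (random_family n (p n)). F \<in> {F. largest_sub free F \<le> t} \<longrightarrow>
          F \<in> {F. - \<theta> * t \<le> - \<theta> * card (F \<inter> L n)}"
        unfolding AE_measure_pmf_iff
      proof (intro ballI impI)
        fix F assume F: "F \<in> set_pmf (random_family n (p n))" "F \<in> {F. largest_sub free F \<le> t}"
        have "F \<subseteq> Pow {1..n}"
          using subsetD[OF set_pmf_random_subset F(1)[unfolded random_family_eq]] by simp
        then have "finite F" by (rule finite_subset) simp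
        then have "card (F \<inter> L n) \<le> largest_sub free F"
          by (intro largest_sub_ge free_subset[OF free[of n]]) auto
        then have "card (F \<inter> L n) \<le> t" using F by simp
        then show "F \<in> {F. - \<theta> * t \<le> - \<theta> * card (F \<inter> L n)}" using \<theta> by simp
      qed
    qed simp
    also have "\<dots> \<le> measure_pmf.expectation (random_family n (p n))
        (\<lambda>F. exp (- \<theta> * card (F \<inter> L n))) * exp (- (- \<theta>) * t)"
      unfolding random_family_eq by (rule prob_le_exp_moment) simp
    also have "measure_pmf.expectation (random_family n (p n)) (\<lambda>F. exp (- \<theta> * card (F \<inter> L n)))
        = measure_pmf.expectation (random_subset (L n) (p n)) (\<lambda>F. exp (- \<theta> * card F))"
      unfolding random_family_eq using L
      by (intro expectation_random_subset_restrict[where g = "\<lambda>F. exp (- \<theta> * card F)"]) auto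
    also have "\<dots> \<le> exp (p n * (exp (- \<theta>) - 1) * card (L n))"
      using finL p by (rule expectation_exp_card_random_subset_le)
    finally have "measure_pmf.prob (random_family n (p n)) {F. largest_sub free F \<le> t}
        \<le> exp (p n * (exp (- \<theta>) - 1) * card (L n)) * exp (- (- \<theta>) * t)"
      by (simp add: mult_right_mono)
    also have "\<dots> = exp (p n * (exp (- \<theta>) - 1) * card (L n) + \<theta> * t)"
      by (simp flip: exp_add)
    also have "p n * (exp (- \<theta>) - 1) * card (L n) \<le> p n * (- (\<theta> * (1 - \<theta>))) * card (L n)"
      using exp_le_quadratic(2)[of \<theta>] \<theta> p
      by (intro mult_right_mono mult_left_mono) (auto simp: algebra_simps power2_eq_square)
    also have "p n * (- (\<theta> * (1 - \<theta>))) * card (L n) = - (p n * (\<theta> * (1 - \<theta>)) * card (L n))"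
      by simp
    also have "\<dots> \<le> - (p n * (\<theta> * (1 - \<theta>)) * ((c - \<epsilon>) * central n))"
      using elim p \<theta> by (intro le_imp_neg_le mult_left_mono) auto
    also have "\<dots> + \<theta> * t = \<theta> * scale n * (\<theta> * (c - \<epsilon>) + \<epsilon> - \<kappa>)"
      by (simp add: t_def algebra_simps)
    also have "\<dots> \<le> \<theta> * scale n * (- \<epsilon>)"
    proof (intro mult_left_mono)
      have "\<theta> * \<epsilon> \<ge> 0" using \<theta> \<epsilon> by simp
      then show "\<theta> * (c - \<epsilon>) + \<epsilon> - \<kappa> \<le> - \<epsilon>"
        using \<theta>c \<epsilon> unfolding right_diff_distrib by (simp add: \<epsilon>_def)
      show "0 \<le> \<theta> * scale n" using \<theta> p central_pos[of n] by simp
    qed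
    finally show ?case by (simp add: t_def mult_ac)
  qed
  from tendsto_sandwich[OF _ this tendsto_const tendsto_exp_neg_mult[OF scale_at_top]]
  show ?thesis using \<theta> \<epsilon> by simp
qed

text \<open>The trivial moment bound holds up to size \<open>(c + \<epsilon>) * central n\<close>.
  Linear splits extend it to \<open>B * central n\<close> and cubic splits to the whole power set,
  each at a cost of \<open>exp (\<eta> * scale n)\<close>; Markov's inequality then applies.\<close>

lemma prob_largest_sub_large:
  assumes lin: "\<And>\<epsilon>. 0 < \<epsilon> \<Longrightarrow> \<exists>\<delta>>0::real. \<forall>\<^sub>F n in sequentially.
      \<forall>C\<subseteq>Pow {1..n}. (c + \<epsilon>) * central n < card C \<longrightarrow> splits s C (\<delta> * n)"
    and cub: "\<exists>B>0. \<forall>\<^sub>F n in sequentially.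
      \<forall>C\<subseteq>Pow {1..n}. B * central n < card C \<longrightarrow> splits s C (real n ^ 3)"
    and \<kappa>: "0 < \<kappa>"
  shows "(\<lambda>n. measure_pmf.prob (random_family n (p n))
    {F. (c + \<kappa>) * scale n \<le> largest_sub free F}) \<longlonglongrightarrow> 0"
proof -
  define \<epsilon> where "\<epsilon> = \<kappa> / 4"
  define \<theta> where "\<theta> = min 1 (\<epsilon> / (c + \<epsilon>))"
  \<comment> \<open>The two phases together cost \<open>2 * \<eta> = \<theta> * \<epsilon>\<close>
    in the exponent, per unit of \<open>scale n\<close>.\<close>
  define \<eta> where "\<eta> = \<theta> * \<epsilon> / 2"
  define E where "E = exp (\<theta> * real (s + 1))"
  have \<epsilon>: "0 < \<epsilon>" and \<theta>: "0 < \<theta>" "\<theta> \<le> 1" using \<kappa> c by (auto simp: \<epsilon>_def \<theta>_def)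
  then have \<eta>: "0 < \<eta>" by (simp add: \<eta>_def)
  have \<theta>c: "\<theta> * (c + \<epsilon>) \<le> \<epsilon>"
  proof -
    have "\<theta> * (c + \<epsilon>) \<le> \<epsilon> / (c + \<epsilon>) * (c + \<epsilon>)" using \<theta> \<epsilon> c by (intro mult_mono) (auto simp: \<theta>_def)
    then show ?thesis using c \<epsilon> by simp
  qed
  obtain \<delta> :: real where \<delta>: "0 < \<delta>" and ev_lin: "\<forall>\<^sub>F n in sequentially.
      \<forall>C\<subseteq>Pow {1..n}. (c + \<epsilon>) * central n < card C \<longrightarrow> splits s C (\<delta> * n)"
    using lin[OF \<epsilon>] by (elim exE conjE)
  obtain B where B: "0 < B" and ev_cub: "\<forall>\<^sub>F n in sequentially.
      \<forall>C\<subseteq>Pow {1..n}. B * central n < card C \<longrightarrow> splits s C (real n ^ 3)"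
    using cub by (elim exE conjE)
  \<comment> \<open>The rate condition of the linear phase, with \<open>p n\<close> cancelled; it
    holds eventually because \<open>p n * n\<close> tends to infinity.\<close>
  have "filterlim (\<lambda>n. \<eta> / B * exp ((\<eta> / B * \<delta>) * (p n * real n))) at_top sequentially"
    using \<eta> B \<delta>
    by (intro filterlim_tendsto_pos_mult_at_top[OF tendsto_const] filterlim_compose[OF exp_at_top] pn) auto
  then have ev1: "\<forall>\<^sub>F n in sequentially. 2 * E \<le> \<eta> / B * exp ((\<eta> / B * \<delta>) * (p n * real n))"
    unfolding filterlim_at_top by blast
  \<comment> \<open>The same for the cubic phase: there the exponent \<open>y1 * n ^ 3\<close> is at
    least \<open>\<eta> * n / 2\<close> as soon as \<open>p n * n \<ge> 1\<close> and
    \<open>n \<ge> 1\<close>.\<close>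
  have "filterlim (\<lambda>n. \<eta> / (real n + 1) * exp (\<eta> * real n / 2)) at_top sequentially"
    using \<eta> by real_asymp
  then have ev2: "\<forall>\<^sub>F n in sequentially. 2 * E \<le> \<eta> / (real n + 1) * exp (\<eta> * real n / 2)"
    unfolding filterlim_at_top by blast
  have ev3: "\<forall>\<^sub>F n in sequentially. 1 \<le> p n * real n"
    using pn unfolding filterlim_at_top by blast
  have "\<forall>\<^sub>F n in sequentially. measure_pmf.prob (random_family n (p n))
    {F. (c + \<kappa>) * scale n \<le> largest_sub free F} \<le> exp (- (\<theta> * \<epsilon>) * scale n)"
    using ev_lin ev_cub ev1 ev2 ev3 eventually_ge_at_top[of 1]
  proof eventually_elim
    case (elim n)
    define V where "V = Pow {1..n}"
    \<comment> \<open>The divisor \<open>n + 1\<close> compensates for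
      \<open>2 ^ n \<le> (n + 1) * central n\<close>, keeping \<open>y1 * card V\<close> below
      \<open>\<eta> * scale n\<close>.\<close>
    define y1 where "y1 = \<eta> * p n / (real n + 1)"
    define y2 where "y2 = \<eta> * p n / B"
    define A0 where "A0 = exp (p n * (exp \<theta> - 1) * ((c + \<epsilon>) * central n))"
    have finV: "finite V" by (simp add: V_def)
    have y: "0 \<le> y1" "0 \<le> y2" using \<eta> p B by (auto simp: y1_def y2_def)
    have base: "exp_moment (p n) \<theta> C \<le> A0" if "C \<subseteq> V" "card C \<le> (c + \<epsilon>) * central n" for C
    proof -
      have "exp_moment (p n) \<theta> C \<le> exp (p n * (exp \<theta> - 1) * card C)"
        using that finV finite_subset \<theta> p by (intro exp_moment_le_card) auto
      also have "\<dots> \<le> A0" unfolding A0_def using that p \<theta> by (auto intro!: mult_left_mono)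
      finally show ?thesis .
    qed
    \<comment> \<open>\<open>y2\<close> handles the \<open>O(central n)\<close> steps of linear degree, \<open>y1\<close> the up to \<open>2 ^ n\<close> earlier
      ones of cubic degree\<close>
    have step2: "exp_moment (p n) \<theta> C \<le> A0 * exp (y2 * card C)" if "C \<subseteq> V" for C
    proof (rule exp_moment_le_splits[OF finV _ p y(2) _ base _ _ that])
      show "2 * p n * exp (\<theta> * (s + 1)) \<le> y2 * exp (y2 * (\<delta> * n))"
        using mult_left_mono[OF elim(3) p(1)[of n]] by (simp add: y2_def E_def mult_ac)
    qed (use elim(1) \<theta> in \<open>auto simp: A0_def V_def\<close>)
    have base1: "exp_moment (p n) \<theta> C \<le> A0 * exp (\<eta> * scale n)"
      if "C \<subseteq> V" "card C \<le> B * central n" for C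
    proof -
      have "y2 * card C \<le> y2 * (B * central n)" using that y by (intro mult_left_mono)
      also have "\<dots> = \<eta> * scale n" using B by (simp add: y2_def)
      finally have "A0 * exp (y2 * card C) \<le> A0 * exp (\<eta> * scale n)" by (simp add: A0_def)
      with step2[OF that(1)] show ?thesis by linarith
    qed
    have "exp_moment (p n) \<theta> V \<le> A0 * exp (\<eta> * scale n) * exp (y1 * card V)"
    proof (rule exp_moment_le_splits[OF finV _ p y(1) _ base1 _ _ order_refl])
      have "real n / 2 \<le> p n * real n * ((real n)\<^sup>2 / (real n + 1))"
      proof -
        have "real n / 2 \<le> 1 * ((real n)\<^sup>2 / (real n + 1))"
          using elim(6) by (simp add: field_simps power2_eq_square)
        also have "\<dots> \<le> p n * real n * ((real n)\<^sup>2 / (real n + 1))"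
          using elim(5) by (intro mult_right_mono) auto
        finally show ?thesis .
      qed
      then have "\<eta> * (real n / 2) \<le> \<eta> * (p n * real n * ((real n)\<^sup>2 / (real n + 1)))"
        using \<eta> by (intro mult_left_mono) auto
      also have "\<dots> = y1 * real n ^ 3"
        by (simp add: y1_def power3_eq_cube power2_eq_square)
      finally have "\<eta> / (real n + 1) * exp (\<eta> * real n / 2) \<le> \<eta> / (real n + 1) * exp (y1 * real n ^ 3)"
        using \<eta> by (intro mult_left_mono) auto
      with elim(4) have "2 * E \<le> \<eta> / (real n + 1) * exp (y1 * real n ^ 3)" by linarith
      from mult_left_mono[OF this p(1)[of n]]
      show "2 * p n * exp (\<theta> * (s + 1)) \<le> y1 * exp (y1 * real n ^ 3)"
        by (simp add: E_def y1_def mult_ac)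
    qed (use elim(2) \<theta> in \<open>auto simp: A0_def V_def\<close>)
    also have "y1 * card V \<le> \<eta> * scale n"
    proof -
      have "y1 * card V \<le> y1 * ((real n + 1) * central n)"
        using y pow2_le_central[of n] by (intro mult_left_mono) (auto simp: V_def card_Pow)
      then show ?thesis by (simp add: y1_def)
    qed
    finally have Z: "exp_moment (p n) \<theta> V \<le> A0 * exp (\<eta> * scale n) * exp (\<eta> * scale n)"
      by (simp add: A0_def)
    have "{F. (c + \<kappa>) * scale n \<le> largest_sub free F} =
        {F. \<theta> * ((c + \<kappa>) * scale n) \<le> \<theta> * largest_sub free F}"
      using \<theta> by auto
    then have "measure_pmf.prob (random_family n (p n)) {F. (c + \<kappa>) * scale n \<le> largest_sub free F}
      \<le> exp_moment (p n) \<theta> V * exp (- \<theta> * ((c + \<kappa>) * scale n))"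
      unfolding random_family_eq exp_moment_def V_def[symmetric]
      using prob_le_exp_moment[OF finV, of "p n" \<theta> "(c + \<kappa>) * scale n" "\<lambda>F. real (largest_sub free F)"] by simp
    also have "\<dots> \<le> A0 * exp (\<eta> * scale n) * exp (\<eta> * scale n) * exp (- \<theta> * ((c + \<kappa>) * scale n))"
      using Z by (intro mult_right_mono) auto
    also have "\<dots> = exp (((exp \<theta> - 1) * (c + \<epsilon>) + 2 * \<eta> - \<theta> * (c + \<kappa>)) * scale n)"
      by (simp add: A0_def algebra_simps flip: exp_add)
    also have "\<dots> \<le> exp (- (\<theta> * \<epsilon>) * scale n)"
    proof -
      have "(exp \<theta> - 1) * (c + \<epsilon>) \<le> (\<theta> + \<theta>\<^sup>2) * (c + \<epsilon>)"
        using exp_le_quadratic(1)[of \<theta>] \<theta> c \<epsilon> by (intro mult_right_mono) auto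
      also have "\<dots> = \<theta> * (c + \<epsilon>) + \<theta> * (\<theta> * (c + \<epsilon>))" by (simp add: power2_eq_square algebra_simps)
      also have "\<dots> \<le> \<theta> * (c + \<epsilon>) + \<theta> * \<epsilon>" using \<theta> \<theta>c by simp
      finally have "(exp \<theta> - 1) * (c + \<epsilon>) + 2 * \<eta> - \<theta> * (c + \<kappa>) \<le> - (\<theta> * \<epsilon>)"
        by (simp add: \<eta>_def \<epsilon>_def algebra_simps)
      then have "((exp \<theta> - 1) * (c + \<epsilon>) + 2 * \<eta> - \<theta> * (c + \<kappa>)) * scale n \<le> - (\<theta> * \<epsilon>) * scale n"
        using p central_pos[of n] by (intro mult_right_mono) auto
      then show ?thesis by simp
    qed
    finally show ?case .
  qed
  from tendsto_sandwich[OF _ this tendsto_const tendsto_exp_neg_mult[OF scale_at_top]]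
  show ?thesis using \<theta> \<epsilon> by simp
qed

text \<open>In \<open>decomp\<close> a family without a split divides into elements with sparse
  upper layers and elements with sparse lower layers. Supersaturation then bounds its size, and the
  number of types needed is at most \<open>c\<close>.\<close>

lemma whp_asymp_largest_sub:
  assumes free: "\<And>n. free (L n)" and L: "\<And>n. L n \<subseteq> Pow {1..n}"
    and card: "\<And>\<epsilon>. 0 < \<epsilon> \<Longrightarrow> \<forall>\<^sub>F n in sequentially. (c - \<epsilon>) * central n \<le> card (L n)"
    and decomp: "\<And>n C (\<Delta> :: real). C \<subseteq> middle {1..n} \<Longrightarrow> \<not> splits s C \<Delta> \<Longrightarrow>
      \<exists>U D. C = U \<union> D \<and> U \<inter> D = {} \<and> (\<forall>v\<in>U. \<forall>d. card (up_layer C v d) \<le> \<Delta>) \<and>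
        (\<forall>v\<in>D. \<forall>d. card (down_layer C v d) \<le> \<Delta>) \<and> (if D = {} then 1 else 2) \<le> c"
  shows "whp_asymp (\<lambda>n. random_family n (p n)) (\<lambda>n F. real (largest_sub free F)) c
    (\<lambda>n. p n * real (n choose (n div 2)))"
proof -
  have trim: "\<forall>\<^sub>F n in sequentially. \<forall>C\<subseteq>Pow {1..n}.
      card C \<le> card (C \<inter> middle {1..n}) + \<epsilon> * central n" if "0 < \<epsilon>" for \<epsilon>
    using card_outside_middle_small[OF that]
  proof eventually_elim
    case (elim n)
    show ?case
    proof (intro allI impI)
      fix C assume C: "C \<subseteq> Pow {1..n}"
      have "C \<subseteq> (C \<inter> middle {1..n}) \<union> (Pow {1..n} - middle {1..n})" using C by blast
      then have "card C \<le> card ((C \<inter> middle {1..n}) \<union> (Pow {1..n} - middle {1..n}))"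
        by (intro card_mono) auto
      also have "\<dots> \<le> card (C \<inter> middle {1..n}) + card (Pow {1..n} - middle {1..n})"
        by (rule card_Un_le)
      finally show "card C \<le> card (C \<inter> middle {1..n}) + \<epsilon> * central n"
        using elim by linarith
    qed
  qed
  have lin: "\<exists>\<delta>>0::real. \<forall>\<^sub>F n in sequentially.
      \<forall>C\<subseteq>Pow {1..n}. (c + \<epsilon>) * central n < card C \<longrightarrow> splits s C (\<delta> * n)" if \<epsilon>: "0 < \<epsilon>" for \<epsilon>
  proof -
    \<comment> \<open>Solves \<open>(1 - 68 * \<delta>) * (c + \<epsilon> / 2) = c\<close>; the
      other half of \<epsilon> pays for sets outside the middle layers.\<close>
    define \<delta> where "\<delta> = \<epsilon> / 2 / (68 * (c + \<epsilon> / 2))"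
    have \<delta>: "0 < \<delta>" "68 * \<delta> \<le> 1" using \<epsilon> c by (auto simp: \<delta>_def field_simps)
    have c\<delta>: "(1 - 68 * \<delta>) * (c + \<epsilon> / 2) = c" using \<epsilon> c by (simp add: \<delta>_def field_simps)
    have "\<forall>\<^sub>F n in sequentially.
      \<forall>C\<subseteq>Pow {1..n}. (c + \<epsilon>) * central n < card C \<longrightarrow> splits s C (\<delta> * n)"
      using trim[OF half_gt_zero[OF \<epsilon>]] eventually_ge_at_top[of 8]
    proof eventually_elim
      case (elim n)
      show ?case
      proof (intro allI impI, rule ccontr)
        fix C assume C: "C \<subseteq> Pow {1..n}" "(c + \<epsilon>) * central n < card C" "\<not> splits s C (\<delta> * n)"
        define C' where "C' = C \<inter> middle {1..n}"
        have sub: "C' \<subseteq> middle {1..n}" by (simp add: C'_def)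
        have "\<not> splits s C' (\<delta> * n)" using C(3) splits_mono[of s C'] unfolding C'_def by blast
        from decomp[OF sub this] obtain U D where UD: "C' = U \<union> D" "U \<inter> D = {}"
          "\<forall>v\<in>U. \<forall>d. card (up_layer C' v d) \<le> \<delta> * n"
          "\<forall>v\<in>D. \<forall>d. card (down_layer C' v d) \<le> \<delta> * n" and D: "(if D = {} then 1 else 2) \<le> c"
          by (elim exE conjE)
        from UD have "(1 - 68 * \<delta>) * card C' \<le>
            (if D = {} then 1 else 2) * real (card {1..n} choose (card {1..n} div 2))"
          using \<delta> elim(2) by (intro supersaturation_linear) (auto simp: C'_def)
        also have "\<dots> \<le> c * central n"
          using D by (simp add: central_def mult_right_mono del: if_split)
        also have "\<dots> = (1 - 68 * \<delta>) * ((c + \<epsilon> / 2) * central n)" using c\<delta> by (metis mult.assoc)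
        finally have *: "(1 - 68 * \<delta>) * card C' \<le> (1 - 68 * \<delta>) * ((c + \<epsilon> / 2) * central n)" .
        \<comment> \<open>Equality would force \<open>c = 0\<close>, whereas \<open>D\<close> shows
          \<open>c \<ge> 1\<close>.\<close>
        have "1 - 68 * \<delta> \<noteq> 0" using c\<delta> D by (auto split: if_splits)
        then have "0 < 1 - 68 * \<delta>" using \<delta> by simp
        with * have "card C' \<le> (c + \<epsilon> / 2) * central n" by (rule mult_left_le_imp_le)
        then show False using elim(1)[rule_format, OF C(1)] C(2) by (simp add: C'_def algebra_simps)
      qed
    qed
    then show ?thesis using \<delta> by blast
  qed
  \<comment> \<open>The constant of \<open>supersaturation_cubic\<close>, plus 1 for the sets
    outside the middle layers.\<close>
  define B :: real where "B = 2 * 65540\<^sup>2 + 1"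
  have "\<forall>\<^sub>F n in sequentially.
      \<forall>C\<subseteq>Pow {1..n}. B * central n < card C \<longrightarrow> splits s C (real n ^ 3)"
    using trim[OF zero_less_one] eventually_ge_at_top[of 16]
  proof eventually_elim
    case (elim n)
    show ?case
    proof (intro allI impI, rule ccontr)
      fix C assume C: "C \<subseteq> Pow {1..n}" "B * central n < card C" "\<not> splits s C (real n ^ 3)"
      define C' where "C' = C \<inter> middle {1..n}"
        have sub: "C' \<subseteq> middle {1..n}" by (simp add: C'_def)
        have "\<not> splits s C' (real n ^ 3)" using C(3) splits_mono[of s C'] unfolding C'_def by blast
      from decomp[OF sub this] obtain U D where UD: "C' = U \<union> D" "U \<inter> D = {}"
        "\<forall>v\<in>U. \<forall>d. card (up_layer C' v d) \<le> real n ^ 3"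
        "\<forall>v\<in>D. \<forall>d. card (down_layer C' v d) \<le> real n ^ 3"
        by (elim exE conjE)
      from UD have "card C' \<le> 2 * 65540\<^sup>2 * real (card {1..n} choose (card {1..n} div 2))"
        using elim(2) by (intro supersaturation_cubic) (auto simp: C'_def)
      then show False using elim(1)[rule_format, OF C(1)] C(2)
        by (simp add: C'_def B_def central_def algebra_simps)
    qed
  qed
  then have cub: "\<exists>B>0. \<forall>\<^sub>F n in sequentially.
      \<forall>C\<subseteq>Pow {1..n}. B * central n < card C \<longrightarrow> splits s C (real n ^ 3)"
    by (intro exI[of _ B]) (simp add: B_def)
  have "whp_asymp (\<lambda>n. random_family n (p n)) (\<lambda>n F. real (largest_sub free F)) c scale"
  proof (rule whp_asympI)
    fix \<kappa> :: real assume \<kappa>: "0 < \<kappa>"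
    let ?P = "\<lambda>n. measure_pmf.prob (random_family n (p n))"
    let ?lo = "\<lambda>n. {F. largest_sub free F \<le> (c - \<kappa>) * scale n}"
    let ?hi = "\<lambda>n. {F. (c + \<kappa>) * scale n \<le> largest_sub free F}"
    let ?bad = "\<lambda>n. {F. \<not> ((c - \<kappa>) * scale n \<le> largest_sub free F \<and>
        largest_sub free F \<le> (c + \<kappa>) * scale n)}"
    have lim: "(\<lambda>n. ?P n (?lo n) + ?P n (?hi n)) \<longlonglongrightarrow> 0"
      using tendsto_add[OF prob_largest_sub_small[OF free L card \<kappa>] prob_largest_sub_large[OF lin cub \<kappa>]]
      by simp
    have bound: "?P n (?bad n) \<le> ?P n (?lo n) + ?P n (?hi n)" for n
    proof -
      have "?P n (?bad n) \<le> ?P n (?lo n \<union> ?hi n)"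
        by (rule measure_pmf.finite_measure_mono) auto
      also have "\<dots> \<le> ?P n (?lo n) + ?P n (?hi n)" by (rule measure_Un_le) auto
      finally show ?thesis .
    qed
    show "(\<lambda>n. ?P n (?bad n)) \<longlonglongrightarrow> 0"
    proof (rule tendsto_sandwich[OF _ _ tendsto_const lim])
      show "\<forall>\<^sub>F n in sequentially. ?P n (?bad n) \<le> ?P n (?lo n) + ?P n (?hi n)"
        using bound by (rule always_eventually[OF allI])
    qed simp
  qed
  then show ?thesis by (simp add: central_def)
qed

end

section \<open>The two forbidden posets\<close>

theorem theorem1p14:
  fixes p :: "nat \<Rightarrow> real"
  assumes "\<And>n. 0 \<le> p n \<and> p n \<le> 1"
    and "p \<in> \<omega>(\<lambda>n. 1 / real n)"
  shows
    "(\<forall>r :: nat.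
        whp_asymp (\<lambda>n. random_family n (p n))
          (\<lambda>n F. real (largest_free (vee (r + 1)) F))
          1 (\<lambda>n. p n * real (n choose (n div 2)))) \<and>
     (\<forall>s t :: nat. s \<ge> 1 \<longrightarrow> t \<ge> 1 \<longrightarrow>
        whp_asymp (\<lambda>n. random_family n (p n))
          (\<lambda>n F. real (largest_free (K_poset s t) F))
          2 (\<lambda>n. p n * real (n choose (n div 2))))"
proof -
  have pn: "filterlim (\<lambda>n. p n * real n) at_top sequentially"
    unfolding filterlim_at_top
  proof
    fix Z :: real
    have "\<forall>\<^sub>F n in sequentially. norm (p n) \<ge> (\<bar>Z\<bar> + 1) * norm (1 / real n)"
      using assms(2) by (rule landau_omega.smallD) simp
    then show "\<forall>\<^sub>F n in sequentially. Z \<le> p n * real n"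
      using eventually_gt_at_top[of 0]
      by eventually_elim (use assms(1) in \<open>auto simp: field_simps\<close>)
  qed
  let ?layer = "\<lambda>n k. {A. A \<subseteq> {1..n} \<and> card A = k}"
  have layer: "card (?layer n k) = n choose k" for n k :: nat
    using n_subsets[of "{1..n}" k] by simp
  have fin: "finite A" if "A \<in> C" "C \<subseteq> middle {1..n}" for A C and n :: nat
    using that finite_subset[of A "{1..n}"] by (auto simp: middle_def)
  have up_sub: "up_layer C v d \<subseteq> C - {v}" and down_sub: "down_layer C v d \<subseteq> C - {v}"
    for C :: "nat set set" and v d
    by (auto simp: up_layer_def down_layer_def)
  have "whp_asymp (\<lambda>n. random_family n (p n)) (\<lambda>n F. real (largest_free (vee (r + 1)) F))
    1 (\<lambda>n. p n * real (n choose (n div 2)))" for r :: nat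
  proof -
    interpret hereditary "induced_free (vee (r + 1)) :: nat set set \<Rightarrow> bool"
      by (rule hereditary_induced_free) (simp add: vee_def Let_def)
    interpret random_hereditary "induced_free (vee (r + 1)) :: nat set set \<Rightarrow> bool" p 1
      by unfold_locales (use assms(1) pn in auto)
    show ?thesis
      unfolding largest_free_eq
    proof (rule whp_asymp_largest_sub[where L = "\<lambda>n. ?layer n (n div 2)" and s = r])
      show "induced_free (vee (r + 1)) (?layer n (n div 2))" for n :: nat
        by (rule induced_free_vee_layer[where k = "n div 2"]) (auto intro: finite_subset)
      show "\<forall>\<^sub>F n in sequentially. (1 - \<epsilon>) * central n \<le> real (card (?layer n (n div 2)))"
        if "0 < \<epsilon>" for \<epsilon> :: real
        using that central_pos unfolding layer central_def[symmetric]
        by (intro always_eventually allI) (auto simp: algebra_simps less_imp_le)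
    next
      fix n :: nat and C :: "nat set set" and \<Delta> :: real
      assume C: "C \<subseteq> middle {1..n}" and no_split: "\<not> splits r C \<Delta>"
      have "card (up_layer C v d) \<le> \<Delta>" if v: "v \<in> C" for v d
      proof (rule ccontr)
        assume "\<not> card (up_layer C v d) \<le> \<Delta>"
        \<comment> \<open>\<open>N1\<close> and \<open>N2\<close> are both this upper layer.\<close>
        then have "splits r C \<Delta>"
          unfolding splits_def using v up_sub[of C v d] vee_free_up_layer[OF fin[OF _ C]]
          by (intro bexI[of _ v] exI[of _ "up_layer C v d"]) auto
        then show False using no_split by simp
      qed
      then show "\<exists>U D. C = U \<union> D \<and> U \<inter> D = {} \<and> (\<forall>v\<in>U. \<forall>d. card (up_layer C v d) \<le> \<Delta>) \<and>
        (\<forall>v\<in>D. \<forall>d. card (down_layer C v d) \<le> \<Delta>) \<and> (if D = {} then 1 else 2) \<le> (1::real)"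
        by (intro exI[of _ C] exI[of _ "{}"]) auto
    qed auto
  qed
  moreover have "whp_asymp (\<lambda>n. random_family n (p n)) (\<lambda>n F. real (largest_free (K_poset s t) F))
    2 (\<lambda>n. p n * real (n choose (n div 2)))" if st: "1 \<le> s" "1 \<le> t" for s t :: nat
  proof -
    interpret hereditary "induced_free (K_poset s t) :: nat set set \<Rightarrow> bool"
      by (rule hereditary_induced_free) (simp add: K_poset_def Let_def)
    interpret random_hereditary "induced_free (K_poset s t) :: nat set set \<Rightarrow> bool" p 2
      by unfold_locales (use assms(1) pn in auto)
    let ?L = "\<lambda>n. ?layer n (n div 2) \<union> ?layer n (Suc (n div 2))"
    show ?thesis
      unfolding largest_free_eq
    proof (rule whp_asymp_largest_sub[where L = ?L and s = "s + t"])
      show "induced_free (K_poset s t) (?L n)" for n :: nat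
        by (rule induced_free_K_poset_layers[where k = "n div 2"]) (use st in \<open>auto intro: finite_subset\<close>)
      show "\<forall>\<^sub>F n in sequentially. (2 - \<epsilon>) * central n \<le> real (card (?L n))"
        if "0 < \<epsilon>" for \<epsilon> :: real
        using central_Suc_ge[OF that]
      proof eventually_elim
        case (elim n)
        have "card (?L n) = (n choose (n div 2)) + (n choose Suc (n div 2))"
          unfolding layer[symmetric] by (intro card_Un_disjoint) auto
        then show ?case using elim by (simp add: central_def algebra_simps)
      qed
    next
      fix n :: nat and C :: "nat set set" and \<Delta> :: real
      assume C: "C \<subseteq> middle {1..n}" and no_split: "\<not> splits (s + t) C \<Delta>"
      \<comment> \<open>Elements with a dense upper layer. Were a lower layer of such an element
        dense as well, the two layers would form a split.\<close>
      define D where "D = {v \<in> C. \<exists>d. \<not> card (up_layer C v d) \<le> \<Delta>}"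
      have "card (down_layer C v d') \<le> \<Delta>" if v: "v \<in> D" for v d'
      proof (rule ccontr)
        assume not: "\<not> card (down_layer C v d') \<le> \<Delta>"
        obtain d where "v \<in> C" "\<not> card (up_layer C v d) \<le> \<Delta>" using v by (auto simp: D_def)
        with not have "splits (s + t) C \<Delta>"
          unfolding splits_def using up_sub[of C v d] down_sub[of C v d'] K_free_layers[OF fin[OF _ C]]
          by (intro bexI[of _ v] exI[of _ "down_layer C v d'"] exI[of _ "up_layer C v d"]) auto
        then show False using no_split by simp
      qed
      then show "\<exists>U D. C = U \<union> D \<and> U \<inter> D = {} \<and> (\<forall>v\<in>U. \<forall>d. card (up_layer C v d) \<le> \<Delta>) \<and>
        (\<forall>v\<in>D. \<forall>d. card (down_layer C v d) \<le> \<Delta>) \<and> (if D = {} then 1 else 2) \<le> (2::real)"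
        by (intro exI[of _ "C - D"] exI[of _ D]) (auto simp: D_def)
    qed auto
  qed
  ultimately show ?thesis by blast
qed

end
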